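(* Let $\mu$ be a geodesic current on $X$. The dual space $X_\mu$ is $0$-hyperbolic if and only if $\mu$ is a measured lamination.
   Context: $X$ is a closed connected orientable hyperbolic surface with universal cover $\widetilde X$, $\partial\widetilde X$ is the boundary at infinity, and $\mathcal G(\widetilde X)=\{(x,y)\in(\partial\widetilde X)^2:x\neq y\}/\big((x,y)\sim(y,x)\big)$ is the space of unoriented bi-infinite geodesics. A geodesic current is a positive $\pi_1(X)$-invariant locally finite Radon measure on $\mathcal G(\widetilde X)$. It is a measured lamination if $i(\mu,\mu)=0$, equivalently if no two geodesics of its support intersect transversely; here $i(\mu,\nu)$ is the total mass of the measure induced by $\mu\times\nu$ on $\mathfrak I/\pi_1(X)$, $\mathfrak I\subset\mathcal G(\widetilde X)^2$ being the set of pairs of transversely intersecting geodesics. Dual space: for a geodesic segment $\tau\subset\widetilde X$ (with or without endpoints), $G(\tau)$ is the set of geodesics meeting $\tau$ transversely, i.e. in exactly one point of $\tau$. Put $d_\mu(\bar x,\bar y)=\frac12\{\mu(G[\bar x,\bar y))+\mu(G(\bar x,\bar y])\}$; $X_\mu$ is the metric quotient $\widetilde X/\{d_\mu=0\}$. A metric space is $0$-hyperbolic if for any four points $x,y,z,w$ the maximum of $d(x,y)+d(z,w)$, $d(x,z)+d(y,w)$, $d(y,z)+d(x,w)$ is attained at least twice. *)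

theory Defs
  imports "HOL-Analysis.Analysis"
begin

section \<open>The hyperbolic plane\<close>

text \<open>
  The hyperbolic plane is the Beltrami--Klein disc: its points are the points of the open unit
  disc, its boundary at infinity is the unit circle, its geodesics are the Euclidean chords, and
  a geodesic segment with end points \<open>x\<close>, \<open>y\<close> is \<open>closed_segment x y\<close>.
\<close>

definition hyp_plane :: "complex set" where
  "hyp_plane = ball 0 1"

definition hyp_boundary :: "complex set" where
  "hyp_boundary = sphere 0 1"

definition hyp_dist :: "complex \<Rightarrow> complex \<Rightarrow> real" where
  "hyp_dist x y = arcosh ((1 - x \<bullet> y) / sqrt ((1 - (norm x)\<^sup>2) * (1 - (norm y)\<^sup>2)))"

definition lorentz_form :: "real^3 \<Rightarrow> real^3 \<Rightarrow> real" where
  "lorentz_form v w = v$1 * w$1 + v$2 * w$2 - v$3 * w$3"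

text \<open>
  The group \<open>O\<^sup>+(2,1)\<close> acts on the closed disc through the projective embedding
  \<open>z \<mapsto> [Re z : Im z : 1]\<close>.  On the open disc this is the full isometry group of \<open>hyp_dist\<close> (the
  condition \<open>A$3$3 > 0\<close> selects one of the two matrices \<open>A\<close>, \<open>-A\<close> inducing the same isometry); on
  the circle it is the continuous extension to the boundary at infinity.  The isometry preserves
  orientation iff \<open>det A = 1\<close>.
\<close>

definition hyp_isometries :: "(real^3^3) set" where
  "hyp_isometries =
     {A. (\<forall>v w. lorentz_form (A *v v) (A *v w) = lorentz_form v w) \<and> A$3$3 > 0}"

definition proj_act :: "real^3^3 \<Rightarrow> complex \<Rightarrow> complex" where
  "proj_act A z =
     (let v = A *v vector [Re z, Im z, 1] in Complex (v$1 / v$3) (v$2 / v$3))"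


section \<open>Closed surfaces and their universal covers\<close>

text \<open>
  The metric of the surface is only used locally; it may be taken to be the Riemannian distance.
  Charts are isometries onto open subsets of the hyperbolic plane, and the orientation is encoded
  by the requirement that the changes of charts preserve the orientation of the plane.
\<close>

definition oriented_hyperbolic_atlas ::
  "'a::metric_space set \<Rightarrow> ('a set \<times> ('a \<Rightarrow> complex)) set \<Rightarrow> bool" where
  "oriented_hyperbolic_atlas X \<A> \<longleftrightarrow>
     (\<forall>(U, \<phi>) \<in> \<A>. openin (top_of_set X) U \<and> \<phi> ` U \<subseteq> hyp_plane \<and> open (\<phi> ` U) \<and>
        (\<forall>a\<in>U. \<forall>b\<in>U. hyp_dist (\<phi> a) (\<phi> b) = dist a b)) \<and>
     (\<Union>(U, \<phi>)\<in>\<A>. U) = X \<and>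
     (\<forall>(U, \<phi>) \<in> \<A>. \<forall>(V, \<psi>) \<in> \<A>. \<forall>a \<in> U \<inter> V.
        \<exists>A \<in> hyp_isometries. det A = 1 \<and>
          (\<exists>W. openin (top_of_set X) W \<and> a \<in> W \<and> W \<subseteq> U \<inter> V \<and>
               (\<forall>b\<in>W. \<psi> b = proj_act A (\<phi> b))))"

definition closed_orientable_hyperbolic_surface :: "'a::metric_space set \<Rightarrow> bool" where
  "closed_orientable_hyperbolic_surface X \<longleftrightarrow>
     X \<noteq> {} \<and> compact X \<and> connected X \<and> (\<exists>\<A>. oriented_hyperbolic_atlas X \<A>)"

text \<open>The universal cover, with the hyperbolic metric lifted from the surface, is the hyperbolic
  plane.\<close>

definition hyperbolic_universal_cover ::
  "'a::metric_space set \<Rightarrow> (complex \<Rightarrow> 'a) \<Rightarrow> bool" where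
  "hyperbolic_universal_cover X p \<longleftrightarrow>
     covering_space hyp_plane p X \<and>
     (\<forall>x\<in>hyp_plane. \<exists>e>0. \<forall>y\<in>hyp_plane. \<forall>z\<in>hyp_plane.
        hyp_dist x y < e \<and> hyp_dist x z < e \<longrightarrow> dist (p y) (p z) = hyp_dist y z)"

text \<open>The fundamental group acts as the group of deck transformations, all of which are
  isometries.\<close>

definition deck_group :: "(complex \<Rightarrow> 'a) \<Rightarrow> (real^3^3) set" where
  "deck_group p = {A \<in> hyp_isometries. \<forall>z\<in>hyp_plane. p (proj_act A z) = p z}"


section \<open>Geodesics and geodesic currents\<close>

text \<open>A bi-infinite unoriented geodesic is the two-element set of its end points at infinity; an
  isometry \<open>A\<close> maps \<open>g\<close> to \<open>proj_act A ` g\<close>.\<close>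

definition geodesics :: "complex set set" where
  "geodesics = {{x, y} | x y. x \<in> hyp_boundary \<and> y \<in> hyp_boundary \<and> x \<noteq> y}"

definition chord :: "complex set \<Rightarrow> complex set" where
  "chord g = convex hull g \<inter> hyp_plane"

definition oriented_geodesics :: "(complex \<times> complex) set" where
  "oriented_geodesics = {(x, y). x \<in> hyp_boundary \<and> y \<in> hyp_boundary \<and> x \<noteq> y}"

text \<open>The quotient topology under \<open>(x, y) \<mapsto> {x, y}\<close>.\<close>

definition geodesic_topology :: "complex set topology" where
  "geodesic_topology = topology (\<lambda>U. U \<subseteq> geodesics \<and>
     openin (top_of_set oriented_geodesics) {(x, y) \<in> oriented_geodesics. {x, y} \<in> U})"

lemma openin_geodesic_topology:
  "openin geodesic_topology U \<longleftrightarrow> U \<subseteq> geodesics \<and>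
     openin (top_of_set oriented_geodesics) {(x, y) \<in> oriented_geodesics. {x, y} \<in> U}"
proof -
  define q where "q = (\<lambda>U. {(x, y) \<in> oriented_geodesics. {x, y} \<in> U})"
  have Int: "q (S \<inter> T) = q S \<inter> q T" for S T
    unfolding q_def by blast
  have Union: "q (\<Union>\<K>) = \<Union>(q ` \<K>)" for \<K>
    unfolding q_def by blast
  have "istopology (\<lambda>U. U \<subseteq> geodesics \<and> openin (top_of_set oriented_geodesics) (q U))"
    unfolding istopology_def Int Union by (blast intro: openin_Int openin_Union)
  then show ?thesis
    unfolding geodesic_topology_def q_def by (simp only: topology_inverse')
qed

definition geodesic_current :: "(complex \<Rightarrow> 'a) \<Rightarrow> complex set measure \<Rightarrow> bool" where
  "geodesic_current p \<mu> \<longleftrightarrow>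
     space \<mu> = geodesics \<and>
     sets \<mu> = sigma_sets geodesics {U. openin geodesic_topology U} \<and>
     (\<forall>g\<in>geodesics. \<exists>U. openin geodesic_topology U \<and> g \<in> U \<and> emeasure \<mu> U < \<infinity>) \<and>
     (\<forall>B\<in>sets \<mu>. emeasure \<mu> B = (SUP K\<in>{K. compactin geodesic_topology K \<and> K \<subseteq> B}. emeasure \<mu> K)) \<and>
     (\<forall>A\<in>deck_group p. \<forall>B\<in>sets \<mu>. emeasure \<mu> ((\<lambda>g. proj_act A ` g) ` B) = emeasure \<mu> B)"


section \<open>Intersection number\<close>

definition transverse_pairs :: "(complex set \<times> complex set) set" where
  "transverse_pairs = {(g, h). g \<in> geodesics \<and> h \<in> geodesics \<and> (\<exists>z. chord g \<inter> chord h = {z})}"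

definition transverse_orbit_rel ::
  "(complex \<Rightarrow> 'a) \<Rightarrow> ((complex set \<times> complex set) \<times> (complex set \<times> complex set)) set" where
  "transverse_orbit_rel p = {(u, v). u \<in> transverse_pairs \<and> v \<in> transverse_pairs \<and>
     (\<exists>A\<in>deck_group p. v = (proj_act A ` fst u, proj_act A ` snd u))}"

text \<open>
  The measure induced by \<open>\<mu> \<times> \<nu>\<close> on the quotient of \<open>transverse_pairs\<close> by the free, properly
  discontinuous action of the fundamental group, i.e. the one for which the quotient map is
  locally measure preserving.  A set \<open>B\<close> of orbits has preimage \<open>\<Union>B\<close>, and its measure is
  attained on the Borel sets \<open>U \<subseteq> \<Union>B\<close> that meet every orbit in \<open>B\<close> exactly once; the supremum
  over the sets meeting every orbit at most once avoids choosing a fundamental domain.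
\<close>

definition induced_measure ::
  "(complex \<Rightarrow> 'a) \<Rightarrow> complex set measure \<Rightarrow> complex set measure \<Rightarrow>
     (complex set \<times> complex set) set measure" where
  "induced_measure p \<mu> \<nu> =
     measure_of (transverse_pairs // transverse_orbit_rel p)
       {B. B \<subseteq> transverse_pairs // transverse_orbit_rel p \<and> \<Union>B \<in> sets (\<mu> \<Otimes>\<^sub>M \<nu>)}
       (\<lambda>B. SUP U\<in>{U \<in> sets (\<mu> \<Otimes>\<^sub>M \<nu>). U \<subseteq> \<Union>B \<and>
                      (\<forall>u\<in>U. \<forall>v\<in>U. (u, v) \<in> transverse_orbit_rel p \<longrightarrow> u = v)}.
              emeasure (\<mu> \<Otimes>\<^sub>M \<nu>) U)"

definition intersection_number ::
  "(complex \<Rightarrow> 'a) \<Rightarrow> complex set measure \<Rightarrow> complex set measure \<Rightarrow> ennreal" where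
  "intersection_number p \<mu> \<nu> =
     emeasure (induced_measure p \<mu> \<nu>) (space (induced_measure p \<mu> \<nu>))"

definition measured_lamination :: "(complex \<Rightarrow> 'a) \<Rightarrow> complex set measure \<Rightarrow> bool" where
  "measured_lamination p \<mu> \<longleftrightarrow> geodesic_current p \<mu> \<and> intersection_number p \<mu> \<mu> = 0"


section \<open>The dual space\<close>

definition transversals :: "complex set \<Rightarrow> complex set set" where
  "transversals \<tau> = {g \<in> geodesics. \<exists>z. chord g \<inter> \<tau> = {z}}"

text \<open>The half-open segments \<open>[x, y)\<close> and \<open>(x, y]\<close> are obtained by removing an end point; both are
  empty if \<open>x = y\<close>.\<close>

definition dual_pseudodist :: "complex set measure \<Rightarrow> complex \<Rightarrow> complex \<Rightarrow> real" where
  "dual_pseudodist \<mu> x y =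
     (measure \<mu> (transversals (closed_segment x y - {y})) +
      measure \<mu> (transversals (closed_segment x y - {x}))) / 2"

definition dual_space :: "complex set measure \<Rightarrow> complex set set" where
  "dual_space \<mu> =
     hyp_plane // {(x, y). x \<in> hyp_plane \<and> y \<in> hyp_plane \<and> dual_pseudodist \<mu> x y = 0}"

text \<open>Since \<open>dual_pseudodist \<mu>\<close> is a pseudometric, the choice of representatives is immaterial.\<close>

definition dual_dist :: "complex set measure \<Rightarrow> complex set \<Rightarrow> complex set \<Rightarrow> real" where
  "dual_dist \<mu> a b = dual_pseudodist \<mu> (SOME x. x \<in> a) (SOME y. y \<in> b)"

definition max_attained_twice :: "real \<Rightarrow> real \<Rightarrow> real \<Rightarrow> bool" where
  "max_attained_twice r s t \<longleftrightarrow>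
     (let m = max r (max s t) in (r = m \<and> s = m) \<or> (r = m \<and> t = m) \<or> (s = m \<and> t = m))"

definition zero_hyperbolic :: "'b set \<Rightarrow> ('b \<Rightarrow> 'b \<Rightarrow> real) \<Rightarrow> bool" where
  "zero_hyperbolic M d \<longleftrightarrow> Metric_space M d \<and>
     (\<forall>x\<in>M. \<forall>y\<in>M. \<forall>z\<in>M. \<forall>w\<in>M.
        max_attained_twice (d x y + d z w) (d x z + d y w) (d y z + d x w))"

end

theory Submission
  imports Defs
begin

text \<open>
  Give a point of the disc the sign \<open>-1\<close>, \<open>0\<close> or \<open>1\<close> according to its side of a geodesic \<open>g\<close>.
  Then \<open>dual_pseudodist \<mu> x y\<close> is the integral over \<open>g\<close> of half the distance between the signs of
  \<open>x\<close> and \<open>y\<close>, so the three sums of the four-point condition are integrals of the corresponding sums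
  for four points on a line.  A single geodesic makes one sum strictly smaller than the other two
  (equal) ones exactly when it splits the four points into two pairs; two geodesics that induce
  different splittings cross.  If no two geodesics of the support cross, at most one splitting
  occurs, and the four-point condition holds.  Conversely, around a crossing point of two geodesics of the
  support there is a parallelogram whose two pairs of opposite sides are split by them, whereas no
  geodesic splits the diagonals, so the sum of the diagonals is the strict maximum.  Finally, the deck
  group acts freely on transverse pairs, so the intersection number vanishes iff no two geodesics
  of the support cross.
\<close>

subsection \<open>Sides of a geodesic\<close>

text \<open>Atoms are the reason for a three-valued sign. A current may charge single geodesics, so
  those passing through one of the four points cannot be discarded as a null set; the sign 0 keeps
  account of them. Consequently splittings appear in two forms. The weak form, in which some of the
  points may lie on the geodesic, is needed to bound the integrands everywhere on the support. The
  strict form is an open condition and provides the neighbourhoods of positive measure from which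
  crossings are detected.

  The support enters only through its complement, the union of all open null sets, so "almost
  everywhere" becomes "on the support" once that union is known to be null.\<close>

definition side :: "complex \<Rightarrow> complex \<Rightarrow> complex \<Rightarrow> real" where
  "side a b z = (Re b - Re a) * (Im z - Im a) - (Im b - Im a) * (Re z - Re a)"

lemma side_swap: "side b a z = - side a b z"
  by (simp add: side_def algebra_simps)

text \<open>Geodesics are straight in the Klein model, so \<open>side a b\<close> is affine along
  segments. Crossings are therefore located as roots of affine functions of one parameter.\<close>

lemma side_convex_comb:
  "side a b ((1 - t) *\<^sub>R x + t *\<^sub>R y) = (1 - t) * side a b x + t * side a b y"
  by (simp add: side_def algebra_simps)

lemma oriented_geodesics_iff:
  "(a, b) \<in> oriented_geodesics \<longleftrightarrow> norm a = 1 \<and> norm b = 1 \<and> a \<noteq> b"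
  by (auto simp: oriented_geodesics_def hyp_boundary_def dist_norm)

lemma geodesicsE:
  assumes "g \<in> geodesics"
  obtains a b where "g = {a, b}" "(a, b) \<in> oriented_geodesics"
  using assms by (auto simp: geodesics_def oriented_geodesics_def)

lemma geodesics_iff: "{a, b} \<in> geodesics \<longleftrightarrow> (a, b) \<in> oriented_geodesics"
  by (auto simp: geodesics_def oriented_geodesics_def doubleton_eq_iff)

lemma oriented_geodesics_swap: "(a, b) \<in> oriented_geodesics \<Longrightarrow> (b, a) \<in> oriented_geodesics"
  by (auto simp: oriented_geodesics_def)

text \<open>Stewart's theorem for the triangle with apex 0. For distinct ends it places the point in
  the open disc exactly when 0 < t < 1, and it shows that the norm is least at t = 1/2.\<close>

lemma norm_chord_point:
  assumes "norm a = 1" "norm b = 1"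
  shows "(norm ((1 - t) *\<^sub>R a + t *\<^sub>R b :: complex))\<^sup>2 = 1 - t * (1 - t) * (norm (b - a))\<^sup>2"
proof -
  have a: "(Re a)\<^sup>2 + (Im a)\<^sup>2 = 1" and b: "(Re b)\<^sup>2 + (Im b)\<^sup>2 = 1"
    using assms by (simp_all add: cmod_power2 [symmetric])
  have "((1 - t) * Re a + t * Re b)\<^sup>2 + ((1 - t) * Im a + t * Im b)\<^sup>2
      = (1 - t) * ((Re a)\<^sup>2 + (Im a)\<^sup>2) + t * ((Re b)\<^sup>2 + (Im b)\<^sup>2)
        - t * (1 - t) * ((Re b - Re a)\<^sup>2 + (Im b - Im a)\<^sup>2)"
    by (simp add: power2_eq_square algebra_simps)
  then show ?thesis
    unfolding cmod_power2 by (simp add: a b)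
qed

lemma collinear_of_side:
  assumes "side a b z = 0" "a \<noteq> b"
  obtains t where "z = (1 - t) *\<^sub>R a + t *\<^sub>R b"
proof (cases "Re a = Re b")
  case True
  with assms have "Im a \<noteq> Im b" by (simp add: complex_eq_iff)
  with True assms have "Re z = Re a" by (auto simp: side_def)
  have "z = (1 - t) *\<^sub>R a + t *\<^sub>R b" if "t = (Im z - Im a) / (Im b - Im a)" for t
  proof -
    have "t * (Im b - Im a) = Im z - Im a" using that \<open>Im a \<noteq> Im b\<close> by simp
    with True \<open>Re z = Re a\<close> show ?thesis
      by (simp add: complex_eq_iff) (simp add: algebra_simps)
  qed
  then show ?thesis using that by blast
next
  case False
  have "z = (1 - t) *\<^sub>R a + t *\<^sub>R b" if "t = (Re z - Re a) / (Re b - Re a)" for t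
  proof -
    have t: "t * (Re b - Re a) = Re z - Re a" using that False by simp
    then have "(Re b - Re a) * (Im z - Im a) = (Re b - Re a) * (t * (Im b - Im a))"
      using assms(1) t by (simp add: side_def mult.commute mult.left_commute)
    then have "Im z - Im a = t * (Im b - Im a)" using False by simp
    with t show ?thesis
      by (simp add: complex_eq_iff) (simp add: algebra_simps)
  qed
  then show ?thesis using that by blast
qed

text \<open>A zero of \<open>side a b\<close> lies somewhere on the line through \<open>a\<close>
  and \<open>b\<close>; being in the open disc makes t * (1 - t) positive, which places it between
  them.\<close>

lemma mem_chord_iff:
  assumes "(a, b) \<in> oriented_geodesics"
  shows "z \<in> chord {a, b} \<longleftrightarrow> z \<in> hyp_plane \<and> side a b z = 0"
proof (intro iffI conjI)
  assume "z \<in> chord {a, b}"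
  then obtain t where z: "z = (1 - t) *\<^sub>R a + t *\<^sub>R b" and "z \<in> hyp_plane"
    by (auto simp: chord_def segment_convex_hull [symmetric] closed_segment_def)
  then show "z \<in> hyp_plane" by simp
  show "side a b z = 0" by (simp add: z side_convex_comb) (simp add: side_def)
next
  assume z: "z \<in> hyp_plane \<and> side a b z = 0"
  from assms have ab: "norm a = 1" "norm b = 1" "a \<noteq> b" by (simp_all add: oriented_geodesics_iff)
  obtain t where t: "z = (1 - t) *\<^sub>R a + t *\<^sub>R b"
    using z ab collinear_of_side by blast
  have "(norm z)\<^sup>2 < 1"
    using z by (simp add: hyp_plane_def power_less_one_iff abs_square_less_1)
  then have "0 < t * (1 - t) * (norm (b - a))\<^sup>2"
    using norm_chord_point [OF ab(1,2), of t] t by simp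
  then have "0 < t * (1 - t)"
    by (simp add: zero_less_mult_iff)
  then have "0 < t" "t < 1"
    by (auto simp: zero_less_mult_iff)
  then show "z \<in> chord {a, b}"
    using z t by (auto simp: chord_def segment_convex_hull [symmetric] closed_segment_def)
qed

lemma convex_hyp_plane: "convex hyp_plane"
  by (simp add: hyp_plane_def)

text \<open>Requiring exactly one point excludes segments contained in the chord, where both sides
  vanish. A zero at \<open>x\<close> counts and a zero at \<open>y\<close> does not, because
  \<open>y\<close> is removed; hence the asymmetry.\<close>

lemma transversals_iff:
  assumes ab: "(a, b) \<in> oriented_geodesics" and xy: "x \<in> hyp_plane" "y \<in> hyp_plane"
  shows "{a, b} \<in> transversals (closed_segment x y - {y}) \<longleftrightarrow>
    side a b x * side a b y < 0 \<or> side a b x = 0 \<and> side a b y \<noteq> 0"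
proof -
  define G where "G = side a b"
  let ?\<tau> = "closed_segment x y - {y}"
  have seg: "closed_segment x y \<subseteq> hyp_plane"
    using xy convex_hyp_plane by (simp add: closed_segment_subset)
  have inter: "chord {a, b} \<inter> ?\<tau> = {z \<in> ?\<tau>. G z = 0}"
    using seg by (auto simp: mem_chord_iff [OF ab] G_def)
  have comb: "G ((1 - t) *\<^sub>R x + t *\<^sub>R y) = (1 - t) * G x + t * G y" for t
    by (simp add: G_def side_convex_comb)
  have in_tau: "z \<in> ?\<tau> \<longleftrightarrow> x \<noteq> y \<and> (\<exists>t. 0 \<le> t \<and> t < 1 \<and> z = (1 - t) *\<^sub>R x + t *\<^sub>R y)" for z
  proof -
    have "(1 - t) *\<^sub>R x + t *\<^sub>R y = y \<longleftrightarrow> t = 1 \<or> x = y" for t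
    proof -
      have "(1 - t) *\<^sub>R x + t *\<^sub>R y = y \<longleftrightarrow> (1 - t) *\<^sub>R (x - y) = 0"
        by (simp add: algebra_simps)
      then show ?thesis by auto
    qed
    then show ?thesis
      by (auto simp: closed_segment_def order.order_iff_strict)
  qed
  have tr: "{a, b} \<in> transversals ?\<tau> \<longleftrightarrow> (\<exists>z. {z \<in> ?\<tau>. G z = 0} = {z})"
    using ab by (simp add: transversals_def geodesics_iff inter)
  consider "G x = 0" "G y = 0" | "G x = 0" "G y \<noteq> 0" | "G x * G y < 0" | "G x \<noteq> 0" "G x * G y \<ge> 0"
    by fastforce
  then show ?thesis
  proof cases
    case 1
    have "\<not> (\<exists>z. {z \<in> ?\<tau>. G z = 0} = {z})"
    proof
      assume "\<exists>z. {z \<in> ?\<tau>. G z = 0} = {z}"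
      then obtain z where z: "{z \<in> ?\<tau>. G z = 0} = {z}" ..
      then have ne: "x \<noteq> y" using in_tau by blast
      have *: "(1 - t) *\<^sub>R x + t *\<^sub>R y = z" if "0 \<le> t" "t < 1" for t
        using z in_tau [of "(1 - t) *\<^sub>R x + t *\<^sub>R y"] that ne comb [of t] 1 by auto
      \<comment> \<open>The parameters 0 and 1/2 would give the same point of a nondegenerate
        segment.\<close>
      from * [of 0] * [of "1/2"] have "(1/2) *\<^sub>R x + (1/2) *\<^sub>R y = x" by simp
      then have "(1/2) *\<^sub>R (y - x) = 0" by (simp add: complex_eq_iff)
      with ne show False by simp
    qed
    then show ?thesis unfolding tr using 1 by (simp add: G_def)
  next
    case 2
    then have "x \<noteq> y" by auto
    have "{z \<in> ?\<tau>. G z = 0} = {x}"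
    proof (intro equalityI subsetI)
      fix z assume "z \<in> {z \<in> ?\<tau>. G z = 0}"
      then obtain t where "z = (1 - t) *\<^sub>R x + t *\<^sub>R y" "G z = 0"
        using in_tau by blast
      then have "t * G y = 0" using comb [of t] 2 by simp
      with 2 \<open>z = _\<close> show "z \<in> {x}" by simp
    qed (use 2 \<open>x \<noteq> y\<close> in auto)
    then show ?thesis unfolding tr using 2 by (auto simp: G_def)
  next
    case 3
    then have "x \<noteq> y" by (auto simp: mult_less_0_iff)
    define t where "t = G x / (G x - G y)"
    have t: "0 < t" "t < 1" using 3 by (auto simp: t_def mult_less_0_iff field_simps)
    have root: "(1 - s) * G x + s * G y = 0 \<longleftrightarrow> s = t" for s
      using 3 by (auto simp: t_def mult_less_0_iff field_simps)
    have "{z \<in> ?\<tau>. G z = 0} = {(1 - t) *\<^sub>R x + t *\<^sub>R y}"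
    proof (intro equalityI subsetI)
      fix z assume "z \<in> {z \<in> ?\<tau>. G z = 0}"
      then obtain s where "z = (1 - s) *\<^sub>R x + s *\<^sub>R y" "G z = 0"
        using in_tau by blast
      then show "z \<in> {(1 - t) *\<^sub>R x + t *\<^sub>R y}" using comb [of s] root [of s] by simp
    next
      fix z assume "z \<in> {(1 - t) *\<^sub>R x + t *\<^sub>R y}"
      then show "z \<in> {z \<in> ?\<tau>. G z = 0}"
        using in_tau [of z] \<open>x \<noteq> y\<close> t comb [of t] root [of t]
        by (metis (mono_tags, lifting) less_imp_le mem_Collect_eq singletonD)
    qed
    then show ?thesis unfolding tr using 3 by (simp add: G_def)
  next
    case 4
    have "{z \<in> ?\<tau>. G z = 0} = {}"
    proof (rule ccontr)
      assume "{z \<in> ?\<tau>. G z = 0} \<noteq> {}"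
      then obtain z where "z \<in> ?\<tau>" "G z = 0" by blast
      then obtain t where t: "0 \<le> t" "t < 1" "(1 - t) * G x + t * G y = 0"
        using in_tau comb by metis
      \<comment> \<open>Multiplying the root equation by \<open>G x\<close> leaves a positive term
        plus a nonnegative one.\<close>
      have "0 = G x * ((1 - t) * G x + t * G y)" using t by simp
      also have "\<dots> = (1 - t) * (G x)\<^sup>2 + t * (G x * G y)"
        by (simp add: power2_eq_square algebra_simps)
      also have "\<dots> > 0"
        using t 4 by (intro add_pos_nonneg mult_nonneg_nonneg [OF t(1)]) auto
      finally show False by simp
    qed
    then show ?thesis unfolding tr using 4 by (auto simp: G_def)
  qed
qed

definition weight :: "complex \<Rightarrow> complex \<Rightarrow> complex set \<Rightarrow> real" where
  "weight x y g = (indicat_real (transversals (closed_segment x y - {y})) g +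
     indicat_real (transversals (closed_segment x y - {x})) g) / 2"

text \<open>Both half-open segments count when the end points are strictly on opposite sides, one of
  them counts when exactly one end point is on the geodesic, and neither counts otherwise.\<close>

lemma weight_eq:
  assumes "(a, b) \<in> oriented_geodesics" "x \<in> hyp_plane" "y \<in> hyp_plane"
  shows "weight x y {a, b} = \<bar>sgn (side a b x) - sgn (side a b y)\<bar> / 2"
  using transversals_iff [OF assms] transversals_iff [OF assms(1,3,2)]
  unfolding weight_def indicator_def closed_segment_commute [of y x]
  by (simp add: sgn_if mult_less_0_iff)

section \<open>Crossings of two geodesics\<close>

lemma affine_root:
  fixes u v :: real
  assumes "u \<le> 0" "0 \<le> v"
  obtains t where "0 \<le> t" "t \<le> 1" "(1 - t) * u + t * v = 0"
proof (cases "u = v")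
  case True
  then show ?thesis using assms that [of 0] by simp
next
  case False
  then have "u - v < 0" using assms by simp
  then show ?thesis using assms by (intro that [of "u / (u - v)"]) (simp_all add: field_simps)
qed

text \<open>\<open>side a b\<close> vanishes somewhere on the segment from \<open>x\<close> to
  \<open>z\<close> and somewhere on the one from \<open>y\<close> to \<open>w\<close>. At these two
  points \<open>side c d\<close> has weakly opposite signs, so it vanishes in between. The set
  \<open>C\<close> is arbitrary in order to confine the crossing point to a small ball when
  needed.\<close>

lemma crossing:
  assumes ab: "(a, b) \<in> oriented_geodesics" and cd: "(c, d) \<in> oriented_geodesics"
    and C: "convex C" "C \<subseteq> hyp_plane" "x \<in> C" "y \<in> C" "z \<in> C" "w \<in> C"
    and G: "max (sgn (side a b x)) (sgn (side a b y)) < min (sgn (side a b z)) (sgn (side a b w))"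
    and H: "max (sgn (side c d x)) (sgn (side c d z)) < min (sgn (side c d y)) (sgn (side c d w))"
  shows "\<exists>m\<in>C. chord {a, b} \<inter> chord {c, d} = {m}"
proof -
  let ?G = "side a b" and ?H = "side c d"
  have G0: "?G x \<le> 0" "?G y \<le> 0" "0 \<le> ?G z" "0 \<le> ?G w"
    using G by (auto simp: sgn_if split: if_splits)
  have H0: "?H x < 0 \<and> ?H z < 0 \<and> 0 \<le> ?H y \<and> 0 \<le> ?H w \<or> ?H x \<le> 0 \<and> ?H z \<le> 0 \<and> 0 < ?H y \<and> 0 < ?H w"
    using H by (auto simp: sgn_if split: if_splits)
  have CC: "(1 - t) *\<^sub>R p + t *\<^sub>R q \<in> C" if "p \<in> C" "q \<in> C" "0 \<le> t" "t \<le> 1" for p q t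
    using C(1) that by (simp add: convex_alt)
  obtain t where t: "0 \<le> t" "t \<le> 1" "(1 - t) * ?G x + t * ?G z = 0"
    using affine_root G0 by metis
  obtain s where s: "0 \<le> s" "s \<le> 1" "(1 - s) * ?G y + s * ?G w = 0"
    using affine_root G0 by metis
  define u where "u = (1 - t) *\<^sub>R x + t *\<^sub>R z"
  define v where "v = (1 - s) *\<^sub>R y + s *\<^sub>R w"
  have uv: "u \<in> C" "v \<in> C" "?G u = 0" "?G v = 0"
    using C CC t s by (auto simp: u_def v_def side_convex_comb)
  have neg: "(1 - t) * p + t * q < 0" if "p < 0" "q < 0" "0 \<le> t" "t \<le> 1" for p q t :: real
    using that by (smt (verit) mult_nonneg_nonpos mult_pos_neg)
  have nonpos: "(1 - t) * p + t * q \<le> 0" if "p \<le> 0" "q \<le> 0" "0 \<le> t" "t \<le> 1" for p q t :: real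
    using that by (smt (verit) mult_nonneg_nonpos)
  have uv': "?H u < 0 \<and> 0 \<le> ?H v \<or> ?H u \<le> 0 \<and> 0 < ?H v"
    using H0 neg [of "?H x" "?H z" t] nonpos [of "?H x" "?H z" t]
      neg [of "- ?H y" "- ?H w" s] nonpos [of "- ?H y" "- ?H w" s] t s
    by (auto simp: u_def v_def side_convex_comb)
  then obtain r where r: "0 \<le> r" "r \<le> 1" "(1 - r) * ?H u + r * ?H v = 0"
    using affine_root [of "?H u" "?H v"] by force
  define m where "m = (1 - r) *\<^sub>R u + r *\<^sub>R v"
  have m: "m \<in> C" "?G m = 0" "?H m = 0"
    using uv CC r by (auto simp: m_def side_convex_comb)
  \<comment> \<open>Two common zeros would span the whole zero line of \<open>side a b\<close>; then
    \<open>side c d\<close> would vanish at both \<open>u\<close> and \<open>v\<close>, against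
    \<open>uv'\<close>.\<close>
  have "m' = m" if "?G m' = 0" "?H m' = 0" for m'
  proof (rule ccontr)
    assume "m' \<noteq> m"
    have "?H q = 0" if q: "?G q = 0" for q
    proof -
      have "a \<noteq> b" using ab by (simp add: oriented_geodesics_iff)
      then have nz: "Re b - Re a \<noteq> 0 \<or> Im b - Im a \<noteq> 0" by (auto simp: complex_eq_iff)
      have "(Re b - Re a) * side m m' q = 0" "(Im b - Im a) * side m m' q = 0"
        using q \<open>?G m' = 0\<close> m(2) unfolding side_def by algebra+
      then have "side m m' q = 0" using nz by auto
      then obtain k where "q = (1 - k) *\<^sub>R m + k *\<^sub>R m'"
        using \<open>m' \<noteq> m\<close> collinear_of_side by metis
      then show ?thesis using m(3) \<open>?H m' = 0\<close> by (simp add: side_convex_comb)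
    qed
    then show False using uv uv' by force
  qed
  moreover have "z \<in> chord {a, b} \<inter> chord {c, d} \<longleftrightarrow> z \<in> hyp_plane \<and> ?G z = 0 \<and> ?H z = 0" for z
    by (simp add: mem_chord_iff [OF ab] mem_chord_iff [OF cd]) blast
  ultimately have "chord {a, b} \<inter> chord {c, d} = {m}"
    using m C(2) by blast
  then show ?thesis using m(1) by blast
qed

text \<open>Provides an arbitrarily small parallelogram centred at the crossing point, with one
  vertex in each of the four sectors cut out by the two geodesics.\<close>

lemma crossing_quadrants:
  assumes ab: "(a, b) \<in> oriented_geodesics" and cd: "(c, d) \<in> oriented_geodesics"
    and m: "chord {a, b} \<inter> chord {c, d} = {m}" and "0 < e"
  obtains v v' where "norm v < e" "norm v' < e"
    "side a b (m - v) < 0" "side a b (m - v') < 0" "side a b (m + v') > 0" "side a b (m + v) > 0"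
    "side c d (m - v) < 0" "side c d (m - v') > 0" "side c d (m + v') < 0" "side c d (m + v) > 0"
proof -
  have m0: "m \<in> hyp_plane" "side a b m = 0" "side c d m = 0"
    using m by (auto simp: mem_chord_iff [OF ab] mem_chord_iff [OF cd] set_eq_iff)
  \<comment> \<open>The determinant of the directions \<open>b - a\<close> and \<open>d - c\<close>.
    If it were 0, a small move along \<open>b - a\<close> would stay on both chords.\<close>
  define k where "k = (Re b - Re a) * (Im d - Im c) - (Im b - Im a) * (Re d - Re c)"
  have G: "side a b (m + p) = (Re b - Re a) * Im p - (Im b - Im a) * Re p" for p
    using m0(2) by (simp add: side_def algebra_simps)
  have H: "side c d (m + p) = (Re d - Re c) * Im p - (Im d - Im c) * Re p" for p
    using m0(3) by (simp add: side_def algebra_simps)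
  obtain \<delta> where \<delta>: "0 < \<delta>" "ball m \<delta> \<subseteq> hyp_plane"
    using m0(1) open_ball by (metis hyp_plane_def open_contains_ball)
  have ne: "norm (b - a) > 0" using ab by (auto simp: oriented_geodesics_iff)
  have "k \<noteq> 0"
  proof
    assume k: "k = 0"
    define l where "l = \<delta> / (2 * norm (b - a))"
    define p where "p = l *\<^sub>R (b - a)"
    have np: "norm p = \<delta> / 2" using ne \<delta> by (simp add: p_def l_def)
    have "side a b (m + p) = 0" unfolding G by (simp add: p_def algebra_simps)
    moreover have "side c d (m + p) = - l * k"
      unfolding H by (simp add: p_def k_def algebra_simps)
    moreover have "m + p \<in> hyp_plane" using \<delta> np by (auto simp: dist_norm)
    ultimately have "m + p \<in> {m}"
      unfolding m [symmetric] using k by (simp add: mem_chord_iff [OF ab] mem_chord_iff [OF cd])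
    then show False using np \<delta> by simp
  qed
  \<comment> \<open>\<open>side a b\<close> changes by \<open>k\<close> along \<open>d - c\<close>
    and by 0 along \<open>b - a\<close>, while \<open>side c d\<close> changes by 0 and by
    \<open>- k\<close>. The additional factor \<open>k\<close> turns these values into squares, so
    the signs do not depend on the orientations.\<close>
  define v0 where "v0 = k *\<^sub>R ((d - c) - (b - a))"
  define v1 where "v1 = k *\<^sub>R ((d - c) + (b - a))"
  define s where "s = e / (norm v0 + norm v1 + 1)"
  have s: "0 < s" using \<open>0 < e\<close> by (simp add: s_def add_nonneg_pos)
  have "s * norm v0 < e" "s * norm v1 < e"
    using \<open>0 < e\<close> by (simp_all add: s_def divide_less_eq add_nonneg_pos algebra_simps add_pos_nonneg)
  then have "norm (s *\<^sub>R v0) < e" "norm (s *\<^sub>R v1) < e" using s by simp_all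
  moreover have "side a b (m + q *\<^sub>R v0) = q * k\<^sup>2" "side a b (m + q *\<^sub>R v1) = q * k\<^sup>2"
    "side c d (m + q *\<^sub>R v0) = q * k\<^sup>2" "side c d (m + q *\<^sub>R v1) = - (q * k\<^sup>2)" for q
    unfolding G H by (simp_all add: v0_def v1_def k_def power2_eq_square algebra_simps)
  from this [of s] this [of "- s"] have
    "side a b (m + s *\<^sub>R v0) = s * k\<^sup>2" "side a b (m + s *\<^sub>R v1) = s * k\<^sup>2"
    "side c d (m + s *\<^sub>R v0) = s * k\<^sup>2" "side c d (m + s *\<^sub>R v1) = - (s * k\<^sup>2)"
    "side a b (m - s *\<^sub>R v0) = - (s * k\<^sup>2)" "side a b (m - s *\<^sub>R v1) = - (s * k\<^sup>2)"
    "side c d (m - s *\<^sub>R v0) = - (s * k\<^sup>2)" "side c d (m - s *\<^sub>R v1) = s * k\<^sup>2"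
    by simp_all
  moreover have "s * k\<^sup>2 > 0" using s \<open>k \<noteq> 0\<close> by simp
  ultimately show ?thesis using that [of "s *\<^sub>R v0" "s *\<^sub>R v1"] by simp
qed


subsection \<open>Regularity of a geodesic current\<close>

lemma continuous_on_side [continuous_intros]:
  assumes "continuous_on S f" "continuous_on S g" "continuous_on S h"
  shows "continuous_on S (\<lambda>x. side (f x) (g x) (h x))"
  unfolding side_def by (intro continuous_intros assms)

definition unoriented :: "(complex \<times> complex) set \<Rightarrow> complex set set" where
  "unoriented P = {{a, b} | a b. (a, b) \<in> P \<and> (a, b) \<in> oriented_geodesics}"

text \<open>The preimage under the quotient map is \<open>P\<close> together with its swapped copy,
  so \<open>P\<close> need not be symmetric.\<close>

lemma openin_unoriented:
  assumes "open P"
  shows "openin geodesic_topology (unoriented P)"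
proof -
  have "{(x, y) \<in> oriented_geodesics. {x, y} \<in> unoriented P} = oriented_geodesics \<inter> (P \<union> prod.swap -` P)"
    using oriented_geodesics_swap by (auto simp: unoriented_def doubleton_eq_iff) metis
  moreover have "open (P \<union> prod.swap -` P)"
    using assms by (intro open_Un open_vimage) (auto simp: prod.swap_def intro!: continuous_intros)
  moreover have "unoriented P \<subseteq> geodesics"
    by (auto simp: unoriented_def geodesics_iff)
  ultimately show ?thesis
    by (simp add: openin_geodesic_topology openin_open_Int)
qed

section \<open>Open sets of geodesics that separate points\<close>

lemma open_side_pos: "open {(a, b). side a b z > 0}" "open {(a, b). side a b z < 0}"
  unfolding case_prod_beta by (auto intro!: open_Collect_less continuous_intros)

text \<open>The strict, hence open, splitting of the four points into {x, y} and {z, w}. Exchanging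
  the two middle arguments gives the splitting into {x, z} and {y, w}.\<close>

definition separating :: "complex \<Rightarrow> complex \<Rightarrow> complex \<Rightarrow> complex \<Rightarrow> complex set set" where
  "separating x y z w = unoriented {(a, b). side a b x < 0 \<and> side a b y < 0 \<and> side a b z > 0 \<and> side a b w > 0}"

lemma openin_separating: "openin geodesic_topology (separating x y z w)"
proof -
  have "{(a, b). side a b x < 0 \<and> side a b y < 0 \<and> side a b z > 0 \<and> side a b w > 0} =
      {(a, b). side a b x < 0} \<inter> {(a, b). side a b y < 0} \<inter> {(a, b). side a b z > 0} \<inter> {(a, b). side a b w > 0}"
    by auto
  then show ?thesis
    unfolding separating_def by (auto intro!: openin_unoriented open_side_pos)
qed

lemma separatingE:
  assumes "g \<in> separating x y z w"
  obtains a b where "g = {a, b}" "(a, b) \<in> oriented_geodesics"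
    "side a b x < 0" "side a b y < 0" "side a b z > 0" "side a b w > 0"
  using assms by (auto simp: separating_def unoriented_def)

lemma separatingI:
  assumes "(a, b) \<in> oriented_geodesics" "side a b x < 0" "side a b y < 0" "side a b z > 0" "side a b w > 0"
  shows "{a, b} \<in> separating x y z w"
  using assms by (auto simp: separating_def unoriented_def)

text \<open>The midpoint is the point of the chord nearest to the centre, since t * (1 - t) is at
  most 1/4.\<close>

lemma norm_chord_midpoint:
  fixes a b z :: complex
  assumes "norm a = 1" "norm b = 1" "z = (1 - t) *\<^sub>R a + t *\<^sub>R b"
  shows "norm (a + b) \<le> 2 * norm z"
proof -
  have "(norm (a + b))\<^sup>2 / 4 = (norm ((1 - 1/2) *\<^sub>R a + (1/2) *\<^sub>R b))\<^sup>2"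
    by (simp add: scaleR_add_right [symmetric] power_divide)
  also have "\<dots> = 1 - 1/4 * (norm (b - a))\<^sup>2"
    using norm_chord_point [OF assms(1,2), of "1/2"] by simp
  also have "\<dots> \<le> 1 - t * (1 - t) * (norm (b - a))\<^sup>2"
  proof -
    have "0 \<le> (t - 1/2)\<^sup>2" by simp
    then have "t * (1 - t) \<le> 1/4" by (simp add: power2_eq_square algebra_simps)
    then have "t * (1 - t) * (norm (b - a))\<^sup>2 \<le> 1/4 * (norm (b - a))\<^sup>2"
      by (rule mult_right_mono) simp
    then show ?thesis by simp
  qed
  also have "\<dots> = (norm z)\<^sup>2"
    using norm_chord_point [OF assms(1,2), of t] assms(3) by simp
  finally have "(norm (a + b))\<^sup>2 \<le> (2 * norm z)\<^sup>2" by (simp add: power_mult_distrib)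
  then show ?thesis by (rule power2_le_imp_le) simp
qed

text \<open>The chords whose midpoint is within distance \<open>r\<close> of the centre. This is a
  closed condition on the end points, and for r < 1 it stays away from the diagonal, where
  \<open>norm (a + b)\<close> is 2.\<close>

definition near_geodesics :: "real \<Rightarrow> complex set set" where
  "near_geodesics r = unoriented {(a, b). norm (a + b) \<le> 2 * r}"

lemma transversals_near:
  assumes "x \<in> hyp_plane" "y \<in> hyp_plane"
  obtains r where "r < 1" "transversals (closed_segment x y - S) \<subseteq> near_geodesics r"
proof
  let ?r = "max (norm x) (norm y)"
  show "?r < 1" using assms by (simp add: hyp_plane_def)
  show "transversals (closed_segment x y - S) \<subseteq> near_geodesics ?r"
  proof
    fix g assume g: "g \<in> transversals (closed_segment x y - S)"
    then obtain z where z: "z \<in> chord g" "z \<in> closed_segment x y" and "g \<in> geodesics"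
      by (auto simp: transversals_def)
    then obtain a b where ab: "g = {a, b}" "(a, b) \<in> oriented_geodesics"
      using geodesicsE by blast
    obtain t where t: "z = (1 - t) *\<^sub>R a + t *\<^sub>R b"
      using z(1) ab by (auto simp: chord_def segment_convex_hull [symmetric] closed_segment_def)
    have "closed_segment x y \<subseteq> cball 0 ?r"
      by (intro closed_segment_subset) auto
    then have "norm z \<le> ?r" using z(2) by auto
    then have "norm (a + b) \<le> 2 * ?r"
      using norm_chord_midpoint [OF _ _ t] ab(2) by (force simp: oriented_geodesics_iff)
    then show "g \<in> near_geodesics ?r"
      using ab by (auto simp: near_geodesics_def unoriented_def)
  qed
qed

locale current =
  fixes p :: "complex \<Rightarrow> 'a::topological_space" and \<mu> :: "complex set measure"
  assumes current: "geodesic_current p \<mu>"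
begin

lemma space_current: "space \<mu> = geodesics"
  and sets_current: "sets \<mu> = sigma_sets geodesics {U. openin geodesic_topology U}"
  using current by (simp_all add: geodesic_current_def)

lemma open_measurable: "openin geodesic_topology U \<Longrightarrow> U \<in> sets \<mu>"
  by (simp add: sets_current sigma_sets.Basic)

text \<open>Local finiteness is carried over to a compact set of pairs of end points by a finite
  subcover. The conclusion offers a measurable superset, which is enough for bounding
  measures.\<close>

lemma near_geodesics_finite:
  assumes "r < 1"
  obtains V where "V \<in> sets \<mu>" "near_geodesics r \<subseteq> V" "emeasure \<mu> V < \<infinity>"
proof -
  define K where "K = {(a, b). norm a = 1 \<and> norm b = 1 \<and> norm (a + b :: complex) \<le> 2 * r}"
  have K_og: "K \<subseteq> oriented_geodesics"
  proof clarify
    fix a b assume ab: "(a, b) \<in> K"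
    have "a \<noteq> b"
    proof
      assume "a = b"
      then have "norm (2 * a) \<le> 2 * r" "norm a = 1" using ab by (simp_all add: K_def flip: mult_2)
      with assms show False by (simp add: norm_mult)
    qed
    with ab show "(a, b) \<in> oriented_geodesics" by (simp add: K_def oriented_geodesics_iff)
  qed
  have "K = (sphere 0 1 \<times> sphere 0 1) \<inter> {q. norm (fst q + snd q) \<le> 2 * r}"
    by (auto simp: K_def)
  moreover have "closed {q :: complex \<times> complex. norm (fst q + snd q) \<le> 2 * r}"
    by (intro closed_Collect_le continuous_intros)
  ultimately have "compact K"
    by (auto intro!: compact_Int_closed compact_Times)
  have "\<exists>U V. openin geodesic_topology U \<and> emeasure \<mu> U < \<infinity> \<and> open V \<and> q \<in> V \<and>
      (\<forall>a b. (a, b) \<in> oriented_geodesics \<inter> V \<longrightarrow> {a, b} \<in> U)" if "q \<in> K" for q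
  proof -
    obtain a b where q: "q = (a, b)" by fastforce
    then have ab: "(a, b) \<in> oriented_geodesics" using that K_og by blast
    then obtain U where U: "openin geodesic_topology U" "{a, b} \<in> U" "emeasure \<mu> U < \<infinity>"
      using current geodesics_iff unfolding geodesic_current_def by blast
    then obtain V where V: "open V" "{(x, y) \<in> oriented_geodesics. {x, y} \<in> U} = oriented_geodesics \<inter> V"
      unfolding openin_geodesic_topology openin_open by blast
    then show ?thesis using U ab q by blast
  qed
  then obtain U V where UV: "\<And>q. q \<in> K \<Longrightarrow> openin geodesic_topology (U q) \<and> emeasure \<mu> (U q) < \<infinity> \<and>
      open (V q) \<and> q \<in> V q \<and> (\<forall>a b. (a, b) \<in> oriented_geodesics \<inter> V q \<longrightarrow> {a, b} \<in> U q)"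
    by metis
  obtain D where D: "D \<subseteq> K" "finite D" "K \<subseteq> (\<Union>q\<in>D. V q)"
    using compactE_image [OF \<open>compact K\<close>, of K V] UV by blast
  have meas: "U q \<in> sets \<mu>" if "q \<in> D" for q
    using that UV D open_measurable by blast
  show thesis
  proof
    show "(\<Union>q\<in>D. U q) \<in> sets \<mu>" using D meas by blast
    show "near_geodesics r \<subseteq> (\<Union>q\<in>D. U q)"
    proof
      fix g assume "g \<in> near_geodesics r"
      then obtain a b where ab: "g = {a, b}" "(a, b) \<in> oriented_geodesics" "(a, b) \<in> K"
        by (auto simp: near_geodesics_def unoriented_def K_def oriented_geodesics_iff)
      then obtain q where "q \<in> D" "(a, b) \<in> V q" using D by blast
      then show "g \<in> (\<Union>q\<in>D. U q)" using UV D ab by blast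
    qed
    have "emeasure \<mu> (\<Union>q\<in>D. U q) \<le> (\<Sum>q\<in>D. emeasure \<mu> (U q))"
      using D meas by (intro emeasure_subadditive_finite) auto
    also have "\<dots> < \<infinity>" using D UV by auto
    finally show "emeasure \<mu> (\<Union>q\<in>D. U q) < \<infinity>" .
  qed
qed

lemma sigma_finite: "sigma_finite_measure \<mu>"
proof
  have "\<exists>V. V \<in> sets \<mu> \<and> near_geodesics (1 - inverse (Suc n)) \<subseteq> V \<and> emeasure \<mu> V < \<infinity>" for n :: nat
    by (rule near_geodesics_finite [of "1 - inverse (Suc n)"]) auto
  then obtain V where V: "\<And>n. V n \<in> sets \<mu>" "\<And>n. near_geodesics (1 - inverse (real (Suc n))) \<subseteq> V n"
    "\<And>n. emeasure \<mu> (V n) < \<infinity>"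
    by metis
  have "geodesics \<subseteq> (\<Union>n. V n)"
  proof
    fix g assume "g \<in> geodesics"
    then obtain a b where g: "g = {a, b}" and ab: "(a, b) \<in> oriented_geodesics"
      using geodesicsE by blast
    have "norm (a + b) < 2"
    proof -
      have "(norm ((1 - 1/2) *\<^sub>R a + (1/2) *\<^sub>R b))\<^sup>2 < 1"
        using ab by (subst norm_chord_point) (auto simp: oriented_geodesics_iff)
      then have "(norm (a + b) / 2)\<^sup>2 < 1" by (simp add: scaleR_add_right [symmetric])
      then show ?thesis by (simp add: abs_square_less_1)
    qed
    then obtain n where "inverse (real (Suc n)) < 1 - norm (a + b) / 2"
      using reals_Archimedean [of "1 - norm (a + b) / 2"] by auto
    then have "norm (a + b) \<le> 2 * (1 - inverse (real (Suc n)))"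
      by (simp add: field_simps)
    then have "g \<in> near_geodesics (1 - inverse (real (Suc n)))"
      using g ab unfolding near_geodesics_def unoriented_def by blast
    then show "g \<in> (\<Union>n. V n)" using V by blast
  qed
  then have "\<Union>(range V) = space \<mu>"
    using V(1) sets.sets_into_space by (fastforce simp: space_current)
  then show "\<exists>A. countable A \<and> A \<subseteq> sets \<mu> \<and> \<Union>A = space \<mu> \<and> (\<forall>a\<in>A. emeasure \<mu> a \<noteq> \<infinity>)"
    using V by (intro exI [of _ "range V"]) (auto simp: less_top)
qed

lemma transversals_measurable:
  assumes "x \<in> hyp_plane" "y \<in> hyp_plane"
  shows "transversals (closed_segment x y - {y}) \<in> sets \<mu>"
proof -
  let ?S = "\<lambda>A. unoriented A"
  let ?pos = "\<lambda>z. {(a, b). side a b z > 0}" and ?neg = "\<lambda>z. {(a, b). side a b z < 0}"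
  \<comment> \<open>\<open>side\<close> changes sign with the orientation, so
    \<open>?S (?pos z)\<close> consists of all geodesics avoiding \<open>z\<close>. The difference
    thus collects those through \<open>x\<close> but not through \<open>y\<close>.\<close>
  have eq: "transversals (closed_segment x y - {y}) =
      ?S (?pos x \<inter> ?neg y) \<union> (?S (?pos y) - ?S (?pos x))"  (is "_ = ?R")
  proof (intro set_eqI)
    fix g
    show "g \<in> transversals (closed_segment x y - {y}) \<longleftrightarrow> g \<in> ?R"
    proof (cases "g \<in> geodesics")
      case True
      then obtain a b where g: "g = {a, b}" and ab: "(a, b) \<in> oriented_geodesics"
        using geodesicsE by blast
      have un: "g \<in> ?S P \<longleftrightarrow> (a, b) \<in> P \<or> (b, a) \<in> P" for P
        using g ab oriented_geodesics_swap by (auto simp: unoriented_def doubleton_eq_iff)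
      show ?thesis
        unfolding Un_iff Diff_iff un
        unfolding g transversals_iff [OF ab assms]
        by (auto simp: side_swap [of b a] mult_less_0_iff)
    next
      case False
      then show ?thesis
        by (auto simp: transversals_def unoriented_def geodesics_iff)
    qed
  qed
  show ?thesis
    unfolding eq by (intro sets.Un sets.Diff open_measurable openin_unoriented open_Int open_side_pos)
qed

text \<open>\<open>measure\<close> takes the default value 0 on sets of infinite mass; finiteness is
  what allows \<open>dual_pseudodist\<close> to be read as an integral.\<close>

lemma transversals_finite:
  assumes "x \<in> hyp_plane" "y \<in> hyp_plane"
  shows "emeasure \<mu> (transversals (closed_segment x y - {y})) < \<infinity>"
proof -
  obtain r where "r < 1" "transversals (closed_segment x y - {y}) \<subseteq> near_geodesics r"
    using transversals_near assms by metis
  moreover then obtain V where "V \<in> sets \<mu>" "near_geodesics r \<subseteq> V" "emeasure \<mu> V < \<infinity>"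
    using near_geodesics_finite by metis
  ultimately show ?thesis
    by (meson emeasure_mono order.trans order_le_less_trans)
qed

lemma
  assumes "x \<in> hyp_plane" "y \<in> hyp_plane"
  shows integrable_weight [intro]: "integrable \<mu> (weight x y)"
    and dual_pseudodist_eq_integral: "dual_pseudodist \<mu> x y = (LINT g|\<mu>. weight x y g)"
proof -
  let ?T = "transversals (closed_segment x y - {y})" and ?T' = "transversals (closed_segment x y - {x})"
  have T: "?T \<in> sets \<mu>" "emeasure \<mu> ?T < \<infinity>" "?T' \<in> sets \<mu>" "emeasure \<mu> ?T' < \<infinity>"
    using transversals_measurable [OF assms] transversals_finite [OF assms]
      transversals_measurable [OF assms(2,1)] transversals_finite [OF assms(2,1)]
    by (simp_all add: closed_segment_commute [of y x])
  have w: "weight x y = (\<lambda>g. (indicat_real ?T g + indicat_real ?T' g) / 2)"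
    by (auto simp: weight_def)
  show "integrable \<mu> (weight x y)"
    unfolding w using T by (intro integrable_divide_zero Bochner_Integration.integrable_add) auto
  have "(LINT g|\<mu>. weight x y g) = ((LINT g|\<mu>. indicat_real ?T g) + (LINT g|\<mu>. indicat_real ?T' g)) / 2"
    unfolding w using T by (simp add: Bochner_Integration.integral_add integrable_indicator)
  then show "dual_pseudodist \<mu> x y = (LINT g|\<mu>. weight x y g)"
    using T by (simp add: dual_pseudodist_def)
qed

definition null_open :: "complex set set" where
  "null_open = \<Union>{U. openin geodesic_topology U \<and> emeasure \<mu> U = 0}"

text \<open>The union is uncountable, but the Lindelof property reduces it to a countable one. It is
  applied to the sets of oriented geodesics, which live in a subspace of a second countable
  space.\<close>

lemma null_open_null: "null_open \<in> null_sets \<mu>"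
proof -
  let ?q = "\<lambda>U. {(x, y) \<in> oriented_geodesics. {x, y} \<in> U}"
  let ?F = "{U. openin geodesic_topology U \<and> emeasure \<mu> U = 0}"
  have op: "openin (top_of_set oriented_geodesics) S" if "S \<in> ?q ` ?F" for S
    using that by (auto simp: openin_geodesic_topology)
  obtain F' where F': "F' \<subseteq> ?q ` ?F" "countable F'" "\<Union>F' = \<Union>(?q ` ?F)"
    by (rule Lindelof_openin [of "?q ` ?F" oriented_geodesics]) (erule op)
  then obtain F where F: "F \<subseteq> ?F" "countable F" "F' = ?q ` F"
    using countable_subset_image [of F' ?q ?F] by blast
  have "null_open \<subseteq> \<Union>F"
  proof
    fix g assume "g \<in> null_open"
    then obtain U where U: "U \<in> ?F" "g \<in> U" by (auto simp: null_open_def)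
    then obtain a b where g: "g = {a, b}" and ab: "(a, b) \<in> oriented_geodesics"
      using geodesicsE by (metis (no_types, lifting) mem_Collect_eq openin_geodesic_topology subsetD)
    then have "(a, b) \<in> \<Union>(?q ` ?F)" using U by blast
    then have "(a, b) \<in> \<Union>(?q ` F)" using F' F by simp
    then show "g \<in> \<Union>F" using g by blast
  qed
  moreover have "\<Union>F \<subseteq> null_open" using F by (auto simp: null_open_def)
  moreover have "(\<Union>U\<in>F. U) \<in> null_sets \<mu>"
    using F open_measurable by (intro null_sets_UN') (auto simp: null_sets_def)
  ultimately show ?thesis by (metis image_ident subset_antisym)
qed

end


subsection \<open>The deck group and transverse pairs\<close>

definition lift :: "complex \<Rightarrow> real^3" where
  "lift z = vector [Re z, Im z, 1]"

lemma lift_nth [simp]: "lift z $ 1 = Re z" "lift z $ 2 = Im z" "lift z $ 3 = 1"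
  by (simp_all add: lift_def)

lemma proj_act_lift: "proj_act A z = Complex ((A *v lift z) $ 1 / (A *v lift z) $ 3) ((A *v lift z) $ 2 / (A *v lift z) $ 3)"
  by (simp add: proj_act_def lift_def Let_def)

lemma matrix_vector_3:
  fixes A :: "real^3^3"
  shows "(A *v v) $ i = A $ i $ 1 * v $ 1 + A $ i $ 2 * v $ 2 + A $ i $ 3 * v $ 3"
  by (simp add: matrix_vector_mult_def sum_3)

lemma matrix_vector_scaleR:
  fixes A :: "real^3^3"
  shows "A *v (c *\<^sub>R v) = c *\<^sub>R (A *v v)"
  by (simp add: vec_eq_iff matrix_vector_3 algebra_simps)

lemma isometry_form: "A \<in> hyp_isometries \<Longrightarrow> lorentz_form (A *v v) (A *v w) = lorentz_form v w"
  by (simp add: hyp_isometries_def)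

lemma lorentz_form_lift: "lorentz_form (lift z) (lift z) = (norm z)\<^sup>2 - 1"
  unfolding cmod_power2 by (simp add: lorentz_form_def power2_eq_square)

lemma lorentz_form_origin: "lorentz_form v (lift 0) = - v $ 3" "lorentz_form (lift 0) v = - v $ 3"
  by (simp_all add: lorentz_form_def)

text \<open>A vector with nonpositive Lorentz form and third coordinate 0 vanishes, so its pairing
  with the image of the origin is 0; but isometries preserve that pairing, which is -1.\<close>

lemma isometry_third_nonzero:
  assumes "A \<in> hyp_isometries" "norm z \<le> 1"
  shows "(A *v lift z) $ 3 \<noteq> 0"
proof
  define w where "w = A *v lift z"
  assume "(A *v lift z) $ 3 = 0"
  then have 3: "w $ 3 = 0" by (simp add: w_def)
  have "(norm z)\<^sup>2 \<le> 1" using assms(2) by (simp add: power_le_one)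
  then have "lorentz_form w w \<le> 0"
    using isometry_form [OF assms(1)] lorentz_form_lift by (simp add: w_def)
  then have "w $ 1 * w $ 1 + w $ 2 * w $ 2 \<le> 0" using 3 by (simp add: lorentz_form_def)
  then have "w $ 1 = 0" "w $ 2 = 0"
    by (simp_all add: sum_squares_le_zero_iff)
  then have "lorentz_form w (A *v lift 0) = 0" using 3 by (simp add: lorentz_form_def)
  then have "lorentz_form (lift z) (lift 0) = 0"
    using isometry_form [OF assms(1)] by (simp add: w_def)
  then show False by (simp add: lorentz_form_origin)
qed

text \<open>The third coordinate is affine along the radius from 0 to \<open>z\<close>, positive at
  0 because of \<open>A$3$3 > 0\<close>, and without zeros in the closed disc.\<close>

lemma isometry_third_pos:
  assumes A: "A \<in> hyp_isometries" and z: "norm z \<le> 1"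
  shows "(A *v lift z) $ 3 > 0"
proof (rule ccontr)
  assume "\<not> (A *v lift z) $ 3 > 0"
  then have "- (A *v lift 0) $ 3 \<le> 0" "0 \<le> - (A *v lift z) $ 3"
    using A by (simp_all add: matrix_vector_3 hyp_isometries_def)
  then obtain t where t: "0 \<le> t" "t \<le> 1" "(1 - t) * (- (A *v lift 0) $ 3) + t * (- (A *v lift z) $ 3) = 0"
    by (rule affine_root)
  have "(A *v lift (t *\<^sub>R z)) $ 3 = 0"
    using t(3) by (simp add: matrix_vector_3 algebra_simps)
  moreover have "norm (t *\<^sub>R z) \<le> 1"
    using t z by (simp add: mult_le_one)
  ultimately show False using isometry_third_nonzero [OF A] by blast
qed

lemma lift_proj_act:
  assumes "A \<in> hyp_isometries" "norm z \<le> 1"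
  shows "A *v lift z = (A *v lift z) $ 3 *\<^sub>R lift (proj_act A z)"
  using isometry_third_nonzero [OF assms]
  by (simp add: vec_eq_iff forall_3 proj_act_lift)

lemma proj_act_eqI:
  assumes "A *v lift z = c *\<^sub>R lift w" "c \<noteq> 0"
  shows "proj_act A z = w"
  using assms(2) unfolding proj_act_lift assms(1) by (simp add: complex_eq_iff)

text \<open>Invariance of the form multiplies \<open>(norm z)\<^sup>2 - 1\<close> by a positive
  factor only, so its sign is kept.\<close>

lemma norm_proj_act:
  assumes A: "A \<in> hyp_isometries" and z: "norm z \<le> 1"
  shows "norm (proj_act A z) \<le> 1" "norm z < 1 \<Longrightarrow> norm (proj_act A z) < 1"
proof -
  let ?c = "(A *v lift z) $ 3"
  have "lorentz_form (A *v lift z) (A *v lift z) = ?c\<^sup>2 * lorentz_form (lift (proj_act A z)) (lift (proj_act A z))"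
    by (subst (1 2) lift_proj_act [OF A z]) (simp add: lorentz_form_def power2_eq_square algebra_simps)
  then have eq: "(norm z)\<^sup>2 - 1 = ?c\<^sup>2 * ((norm (proj_act A z))\<^sup>2 - 1)"
    by (simp only: isometry_form [OF A] lorentz_form_lift)
  have c: "?c\<^sup>2 > 0" using isometry_third_pos [OF A z] by simp
  have "(norm z)\<^sup>2 \<le> 1" using z by (simp add: power_le_one)
  then have "(norm (proj_act A z))\<^sup>2 \<le> 1"
    using eq c by (metis diff_le_0_iff_le mult_le_0_iff not_less)
  then show "norm (proj_act A z) \<le> 1" by (simp add: abs_square_le_1)
  assume "norm z < 1"
  then have "(norm z)\<^sup>2 < 1" by (simp add: abs_square_less_1)
  then have "(norm (proj_act A z))\<^sup>2 < 1"
    using eq c by (metis diff_less_0_iff_less mult_less_0_iff not_less_iff_gr_or_eq)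
  then show "norm (proj_act A z) < 1" by (simp add: abs_square_less_1)
qed

lemma proj_act_hyp_plane:
  "A \<in> hyp_isometries \<Longrightarrow> z \<in> hyp_plane \<Longrightarrow> proj_act A z \<in> hyp_plane"
  using norm_proj_act by (simp add: hyp_plane_def)

lemma proj_act_compose:
  assumes A: "A \<in> hyp_isometries" and B: "B \<in> hyp_isometries" and z: "norm z \<le> 1"
  shows "proj_act (A ** B) z = proj_act A (proj_act B z)"
proof (rule proj_act_eqI)
  show "(A ** B) *v lift z = ((B *v lift z) $ 3 * (A *v lift (proj_act B z)) $ 3) *\<^sub>R
      lift (proj_act A (proj_act B z))"
    unfolding matrix_vector_mul_assoc [symmetric]
    by (subst lift_proj_act [OF B z], subst matrix_vector_scaleR,
        subst lift_proj_act [OF A norm_proj_act(1) [OF B z]]) simp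
  show "(B *v lift z) $ 3 * (A *v lift (proj_act B z)) $ 3 \<noteq> 0"
    using isometry_third_nonzero [OF B z] isometry_third_nonzero [OF A norm_proj_act(1) [OF B z]] by simp
qed

lemma proj_act_id: "proj_act (mat 1) z = z"
  by (rule proj_act_eqI [where c = 1]) simp_all

lemma hyp_isometries_id: "mat 1 \<in> hyp_isometries"
  by (simp add: hyp_isometries_def) (simp add: mat_def)

lemma third_column:
  fixes A :: "real^3^3"
  shows "(A *v lift 0) $ 3 = A $ 3 $ 3"
  by (simp add: matrix_vector_3)

text \<open>Only the sign condition needs an argument: the corner entry is the third coordinate of
  the image of \<open>lift 0\<close>, a product of two positive scale factors.\<close>

lemma hyp_isometries_mult:
  assumes A: "A \<in> hyp_isometries" and B: "B \<in> hyp_isometries"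
  shows "A ** B \<in> hyp_isometries"
proof -
  have "((A ** B) *v lift 0) $ 3 = (B *v lift 0) $ 3 * (A *v lift (proj_act B 0)) $ 3"
    unfolding matrix_vector_mul_assoc [symmetric]
    by (subst lift_proj_act [OF B], simp, subst matrix_vector_scaleR) simp
  also have "\<dots> > 0"
    using isometry_third_pos [OF B, of 0] isometry_third_pos [OF A, of "proj_act B 0"] norm_proj_act [OF B, of 0]
    by simp
  finally show ?thesis
    unfolding third_column using isometry_form [OF A] isometry_form [OF B]
    by (simp add: hyp_isometries_def matrix_vector_mul_assoc [symmetric])
qed

text \<open>Nondegeneracy of the form makes the kernel trivial. The inverse is the adjoint for the
  form, and therefore has the same corner entry.\<close>

lemma hyp_isometries_inverse:
  assumes A: "A \<in> hyp_isometries"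
  obtains B where "B \<in> hyp_isometries" "A ** B = mat 1" "B ** A = mat 1"
proof -
  have "v = 0" if v: "A *v v = 0" for v
  proof -
    have "lorentz_form v w = 0" for w
      using isometry_form [OF A, of v w] v by (simp add: lorentz_form_def)
    from this [of "vector [1, 0, 0]"] this [of "vector [0, 1, 0]"] this [of "vector [0, 0, 1]"]
    show ?thesis by (simp add: lorentz_form_def vec_eq_iff forall_3)
  qed
  then obtain B where BA: "B ** A = mat 1"
    using matrix_left_invertible_ker [of A] by blast
  then have AB: "A ** B = mat 1" by (simp add: matrix_left_right_inverse)
  then have ABv: "A *v (B *v v) = v" for v by (simp add: matrix_vector_mul_assoc)
  have form: "lorentz_form (B *v v) (B *v w) = lorentz_form v w" for v w
    using isometry_form [OF A, of "B *v v" "B *v w"] by (simp add: ABv)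
  have "lorentz_form (B *v lift 0) (lift 0) = lorentz_form (lift 0) (A *v lift 0)"
    using isometry_form [OF A, of "B *v lift 0" "lift 0"] by (simp add: ABv)
  then have "B $ 3 $ 3 = A $ 3 $ 3" by (simp add: lorentz_form_origin third_column)
  then have "B \<in> hyp_isometries" using A form by (simp add: hyp_isometries_def)
  then show thesis using that AB BA by blast
qed

lemma proj_act_chord:
  assumes A: "A \<in> hyp_isometries" and ab: "(a, b) \<in> oriented_geodesics" and z: "z \<in> chord {a, b}"
  shows "proj_act A z \<in> chord (proj_act A ` {a, b})"
proof -
  obtain t where t: "0 \<le> t" "t \<le> 1" "z = (1 - t) *\<^sub>R a + t *\<^sub>R b" and zh: "z \<in> hyp_plane"
    using z by (auto simp: chord_def segment_convex_hull [symmetric] closed_segment_def)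
  have n: "norm a \<le> 1" "norm b \<le> 1" "norm z \<le> 1"
    using ab zh by (auto simp: oriented_geodesics_iff hyp_plane_def)
  define \<alpha> \<beta> \<gamma> where "\<alpha> = (A *v lift a) $ 3" and "\<beta> = (A *v lift b) $ 3" and "\<gamma> = (A *v lift z) $ 3"
  have pos: "\<alpha> > 0" "\<beta> > 0" "\<gamma> > 0"
    using isometry_third_pos [OF A] n by (simp_all add: \<alpha>_def \<beta>_def \<gamma>_def)
  \<comment> \<open>Projective maps preserve lines but not affine parameters: \<open>t\<close> is
    reweighted by the homogeneous scale factors of the end points.\<close>
  define s where "s = t * \<beta> / \<gamma>"
  have comb: "(A *v lift z) $ i = (1 - t) * (A *v lift a) $ i + t * (A *v lift b) $ i" for i
    by (simp add: matrix_vector_3 t(3) algebra_simps)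
  have \<gamma>: "\<gamma> = (1 - t) * \<alpha> + t * \<beta>"
    unfolding \<alpha>_def \<beta>_def \<gamma>_def by (rule comb)
  then have s: "s = t * \<beta> / \<gamma>" "1 - s = (1 - t) * \<alpha> / \<gamma>"
    using pos by (simp_all add: s_def field_simps)
  have "0 \<le> s" using s(1) t pos by simp
  moreover have "0 \<le> 1 - s" unfolding s(2) using t pos by simp
  moreover have "proj_act A z = (1 - s) *\<^sub>R proj_act A a + s *\<^sub>R proj_act A b"
    unfolding complex_eq_iff s(2) unfolding s(1) using pos
    by (simp add: proj_act_lift \<alpha>_def [symmetric] \<beta>_def [symmetric] \<gamma>_def [symmetric] \<gamma> [symmetric] comb add_divide_distrib)
  ultimately show ?thesis
    using proj_act_hyp_plane [OF A zh]
    by (auto simp: chord_def segment_convex_hull [symmetric] closed_segment_def)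
qed

lemma continuous_on_proj_act:
  assumes "A \<in> hyp_isometries"
  shows "continuous_on hyp_plane (proj_act A)"
proof -
  have "A $ 3 $ 1 * Re z + A $ 3 $ 2 * Im z + A $ 3 $ 3 \<noteq> 0" if "z \<in> hyp_plane" for z
    using isometry_third_nonzero [OF assms, of z] that by (simp add: matrix_vector_3 hyp_plane_def)
  then show ?thesis
    unfolding proj_act_lift Complex_eq matrix_vector_3 lift_nth mult_1_right
    by (intro continuous_intros) auto
qed

text \<open>Lifts of points of \<open>V\<close> are eigenvectors. The resulting equations are
  quadratic in the coordinates and hold on a small disc, so comparing coefficients makes
  \<open>A\<close> a scalar matrix, which acts trivially up to the boundary.\<close>

lemma proj_act_trivial:
  assumes A: "A \<in> hyp_isometries" and V: "open V" "V \<noteq> {}" "V \<subseteq> hyp_plane"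
    and fix_V: "\<And>z. z \<in> V \<Longrightarrow> proj_act A z = z" and z: "norm z \<le> 1"
  shows "proj_act A z = z"
proof -
  obtain q where "q \<in> V" using V by blast
  then obtain e where e: "0 < e" "ball q e \<subseteq> V" using V open_contains_ball by blast
  define f where "f i x y = A $ i $ 1 * x + A $ i $ 2 * y + A $ i $ 3" for i x y
  define x0 y0 d where "x0 = Re q" and "y0 = Im q" and "d = e / 2"
  have d: "d > 0" using e by (simp add: d_def)
  have eig: "f 1 (x0 + s) (y0 + t) = (x0 + s) * f 3 (x0 + s) (y0 + t)"
      "f 2 (x0 + s) (y0 + t) = (y0 + t) * f 3 (x0 + s) (y0 + t)" if "\<bar>s\<bar> + \<bar>t\<bar> < e" for s t
  proof -
    define u where "u = Complex (x0 + s) (y0 + t)"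
    have "dist q u \<le> \<bar>s\<bar> + \<bar>t\<bar>"
      using cmod_le [of "q - u"] by (simp add: dist_norm u_def x0_def y0_def)
    then have "u \<in> V" using that e by auto
    moreover from this have "norm u \<le> 1" using V by (auto simp: hyp_plane_def)
    ultimately have "A *v lift u = (A *v lift u) $ 3 *\<^sub>R lift u"
      using lift_proj_act [OF A, of u] fix_V by simp
    then have "(A *v lift u) $ 1 = (A *v lift u) $ 3 * Re u" "(A *v lift u) $ 2 = (A *v lift u) $ 3 * Im u"
      by (metis lift_nth(1) scaleR_conv_of_real vector_scaleR_component real_scaleR_def,
          metis lift_nth(2) scaleR_conv_of_real vector_scaleR_component real_scaleR_def)
    then show "f 1 (x0 + s) (y0 + t) = (x0 + s) * f 3 (x0 + s) (y0 + t)"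
      "f 2 (x0 + s) (y0 + t) = (y0 + t) * f 3 (x0 + s) (y0 + t)"
      by (simp_all add: matrix_vector_3 f_def u_def mult.commute)
  qed
  have small: "\<bar>0\<bar> + \<bar>0\<bar> < e" "\<bar>d\<bar> + \<bar>0\<bar> < e" "\<bar>0\<bar> + \<bar>d\<bar> < e" "\<bar>d/2\<bar> + \<bar>d/2\<bar> < e" "\<bar>-d\<bar> + \<bar>0\<bar> < e" "\<bar>0\<bar> + \<bar>-d\<bar> < e"
    using d e by (auto simp: d_def)
  note E = small [THEN eig(1)] small [THEN eig(2)]
  \<comment> \<open>A second difference over -d, 0 and d: the affine side of the equation cancels,
    and only the quadratic coefficient of the other side remains.\<close>
  have "A $ 3 $ 1 * (d * d) = 0"
    using E(1,2,5) unfolding f_def by algebra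
  then have 31: "A $ 3 $ 1 = 0" using d by simp
  have "A $ 3 $ 2 * (d * d) = 0"
    using E(7,9,12) unfolding f_def by algebra
  then have 32: "A $ 3 $ 2 = 0" using d by simp
  have "d * (A $ 1 $ 1 - A $ 3 $ 3) = 0" "d * A $ 1 $ 2 = 0" "d * A $ 2 $ 1 = 0" "d * (A $ 2 $ 2 - A $ 3 $ 3) = 0"
    using E(1,2,3,7,8,9) unfolding f_def 31 32 by algebra+
  then have 1: "A $ 1 $ 1 = A $ 3 $ 3" "A $ 1 $ 2 = 0" "A $ 2 $ 1 = 0" "A $ 2 $ 2 = A $ 3 $ 3"
    using d by simp_all
  then have "A $ 1 $ 3 = 0" "A $ 2 $ 3 = 0"
    using E(1,7) unfolding f_def 31 32 by simp_all
  then have "A *v lift z = A $ 3 $ 3 *\<^sub>R lift z"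
    using 1 31 32 by (simp add: vec_eq_iff forall_3 matrix_vector_3)
  moreover have "A $ 3 $ 3 \<noteq> 0" using A by (simp add: hyp_isometries_def)
  ultimately show ?thesis by (rule proj_act_eqI)
qed

section \<open>Freeness of the deck group\<close>

lemma deck_group_isometry: "A \<in> deck_group p \<Longrightarrow> A \<in> hyp_isometries"
  by (simp add: deck_group_def)

text \<open>Near \<open>m\<close> both a point and its image lie in \<open>V\<close> and have the
  same projection; injectivity of \<open>p\<close> there makes \<open>A\<close> the identity on an
  open set.\<close>

lemma deck_group_free:
  assumes A: "A \<in> deck_group p" and V: "open V" "V \<subseteq> hyp_plane" "inj_on p V"
    and m: "m \<in> V" "proj_act A m \<in> V" and z: "norm z \<le> 1"
  shows "proj_act A z = z"
proof -
  have A': "A \<in> hyp_isometries" by (rule deck_group_isometry [OF A])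
  define W where "W = V \<inter> proj_act A -` V"
  have pA: "p (proj_act A q) = p q" if "q \<in> V" for q
    using A V that by (auto simp: deck_group_def)
  have "open W"
    unfolding W_def using continuous_on_subset [OF continuous_on_proj_act [OF A'] V(2)] V(1) V(1)
    by (rule continuous_open_preimage)
  moreover have "m \<in> W" using m by (simp add: W_def)
  moreover have "proj_act A q = q" if "q \<in> W" for q
    using inj_onD [OF V(3) pA] that by (auto simp: W_def)
  moreover have "W \<subseteq> hyp_plane" using V by (auto simp: W_def)
  ultimately show ?thesis
    using proj_act_trivial [OF A' _ _ _ _ z, of W] by blast
qed

section \<open>Transverse pairs and their orbits\<close>

lemma transverse_pairsE:
  assumes "(g, h) \<in> transverse_pairs"
  obtains a b c d m where "g = {a, b}" "(a, b) \<in> oriented_geodesics" "h = {c, d}" "(c, d) \<in> oriented_geodesics"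
    "chord g \<inter> chord h = {m}"
proof -
  obtain m where gh: "g \<in> geodesics" "h \<in> geodesics" and m: "chord g \<inter> chord h = {m}"
    using assms by (auto simp: transverse_pairs_def)
  obtain a b where "g = {a, b}" "(a, b) \<in> oriented_geodesics"
    using gh(1) by (rule geodesicsE)
  moreover obtain c d where "h = {c, d}" "(c, d) \<in> oriented_geodesics"
    using gh(2) by (rule geodesicsE)
  ultimately show thesis using m that by blast
qed

lemma separating_crossing:
  assumes "g \<in> separating x y z w" "h \<in> separating x z y w"
    and "convex C" "C \<subseteq> hyp_plane" "x \<in> C" "y \<in> C" "z \<in> C" "w \<in> C"
  shows "\<exists>m\<in>C. chord g \<inter> chord h = {m}"
proof -
  obtain a b where ab: "g = {a, b}" "(a, b) \<in> oriented_geodesics"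
    "side a b x < 0" "side a b y < 0" "side a b z > 0" "side a b w > 0"
    using assms(1) by (rule separatingE)
  obtain c d where cd: "h = {c, d}" "(c, d) \<in> oriented_geodesics"
    "side c d x < 0" "side c d z < 0" "side c d y > 0" "side c d w > 0"
    using assms(2) by (rule separatingE)
  show ?thesis
    unfolding ab(1) cd(1) using ab cd by (intro crossing [OF ab(2) cd(2) assms(3-8)]) simp_all
qed

lemma separating_geodesics: "separating x y z w \<subseteq> geodesics"
  by (auto simp: separating_def unoriented_def geodesics_iff)

lemma separating_transverse:
  assumes "g \<in> separating x y z w" "h \<in> separating x z y w"
    and "x \<in> hyp_plane" "y \<in> hyp_plane" "z \<in> hyp_plane" "w \<in> hyp_plane"
  shows "(g, h) \<in> transverse_pairs"
  using separating_crossing [OF assms(1,2) convex_hyp_plane order_refl assms(3-6)]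
    subsetD [OF separating_geodesics assms(1)] subsetD [OF separating_geodesics assms(2)]
  by (auto simp: transverse_pairs_def)

text \<open>The composition law of \<open>proj_act\<close> is available on the closed disc, so it is
  applied to geodesics through their end points, which have norm 1.\<close>

lemma equiv_transverse_orbit_rel: "equiv transverse_pairs (transverse_orbit_rel p)"
proof (rule equivI)
  have norm1: "norm a \<le> 1" if "a \<in> g" "g \<in> geodesics" for a g
    using that by (auto simp: geodesics_def hyp_boundary_def)
  have geod: "g \<in> geodesics" "h \<in> geodesics" if "(g, h) \<in> transverse_pairs" for g h
    using that by (auto simp: transverse_pairs_def)
  show "transverse_orbit_rel p \<subseteq> transverse_pairs \<times> transverse_pairs"
    by (auto simp: transverse_orbit_rel_def)
  have "mat 1 \<in> deck_group p"
    by (simp add: deck_group_def hyp_isometries_id proj_act_id)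
  moreover have "proj_act (mat 1) ` g = g" for g
    by (simp add: proj_act_id)
  ultimately show "refl_on transverse_pairs (transverse_orbit_rel p)"
    unfolding refl_on_def transverse_orbit_rel_def by (auto intro!: bexI [of _ "mat 1"] simp: proj_act_id)
  show "sym (transverse_orbit_rel p)"
  proof (rule symI)
    fix u v assume "(u, v) \<in> transverse_orbit_rel p"
    then obtain A where u: "u \<in> transverse_pairs" "v \<in> transverse_pairs" and A: "A \<in> deck_group p"
      and v: "v = (proj_act A ` fst u, proj_act A ` snd u)"
      by (auto simp: transverse_orbit_rel_def)
    have A': "A \<in> hyp_isometries" by (rule deck_group_isometry [OF A])
    obtain B where B: "B \<in> hyp_isometries" "A ** B = mat 1" "B ** A = mat 1"
      using hyp_isometries_inverse [OF A'] by blast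
    have AB: "proj_act A (proj_act B z) = z" "proj_act B (proj_act A z) = z" if "norm z \<le> 1" for z
      using proj_act_compose [OF A' B(1) that] proj_act_compose [OF B(1) A' that] B by (simp_all add: proj_act_id)
    have "p (proj_act B z) = p z" if "z \<in> hyp_plane" for z
    proof -
      have "p (proj_act A (proj_act B z)) = p (proj_act B z)"
        using A proj_act_hyp_plane [OF B(1) that] by (simp add: deck_group_def)
      then show ?thesis using AB that by (simp add: hyp_plane_def)
    qed
    then have "B \<in> deck_group p" using B by (simp add: deck_group_def)
    moreover have "proj_act B ` proj_act A ` g = g" if "g \<in> geodesics" for g
      using AB(2) norm1 that by (force simp: image_image)
    then have "u = (proj_act B ` fst v, proj_act B ` snd v)"
      using u(1) geod by (cases u) (simp add: v)
    ultimately show "(v, u) \<in> transverse_orbit_rel p"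
      using u by (auto simp: transverse_orbit_rel_def)
  qed
  show "trans (transverse_orbit_rel p)"
  proof (rule transI)
    fix u v w assume "(u, v) \<in> transverse_orbit_rel p" "(v, w) \<in> transverse_orbit_rel p"
    then obtain A B where u: "u \<in> transverse_pairs" "w \<in> transverse_pairs" and AB: "A \<in> deck_group p" "B \<in> deck_group p"
      and v: "v = (proj_act A ` fst u, proj_act A ` snd u)" "w = (proj_act B ` fst v, proj_act B ` snd v)"
      by (auto simp: transverse_orbit_rel_def)
    note I = AB [THEN deck_group_isometry]
    have comp: "proj_act (B ** A) z = proj_act B (proj_act A z)" if "norm z \<le> 1" for z
      using that by (rule proj_act_compose [OF I(2,1)])
    have "B ** A \<in> deck_group p"
      using AB hyp_isometries_mult [OF I(2,1)] proj_act_hyp_plane [OF I(1)] comp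
      by (auto simp: deck_group_def hyp_plane_def)
    moreover have "proj_act (B ** A) ` g = proj_act B ` proj_act A ` g" if "g \<in> geodesics" for g
      using comp norm1 that by (force simp: image_image)
    then have "w = (proj_act (B ** A) ` fst u, proj_act (B ** A) ` snd u)"
      using u(1) geod by (cases u) (simp add: v)
    ultimately show "(u, w) \<in> transverse_orbit_rel p"
      using u by (auto simp: transverse_orbit_rel_def)
  qed
qed

text \<open>A countable union of rectangles gives measurability in the product sigma-algebra. The
  four sectors at a crossing are open, so sample points can be chosen in a countable dense
  set.\<close>

lemma transverse_pairs_countable_cover:
  obtains D where "countable D" "D \<subseteq> hyp_plane"
    "transverse_pairs = (\<Union>x\<in>D. \<Union>y\<in>D. \<Union>z\<in>D. \<Union>w\<in>D. separating x y z w \<times> separating x z y w)"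
proof -
  obtain D :: "complex set" where D: "countable D" "\<And>X. open X \<Longrightarrow> X \<noteq> {} \<Longrightarrow> \<exists>d\<in>D. d \<in> X"
    using countable_dense_exists by blast
  let ?D = "D \<inter> hyp_plane"
  have "transverse_pairs \<subseteq> (\<Union>x\<in>?D. \<Union>y\<in>?D. \<Union>z\<in>?D. \<Union>w\<in>?D. separating x y z w \<times> separating x z y w)"
  proof clarify
    fix g h assume "(g, h) \<in> transverse_pairs"
    then obtain a b c d m where g: "g = {a, b}" and ab: "(a, b) \<in> oriented_geodesics"
      and h: "h = {c, d}" and cd: "(c, d) \<in> oriented_geodesics" and m: "chord g \<inter> chord h = {m}"
      by (rule transverse_pairsE)
    have "m \<in> hyp_plane" using m by (auto simp: chord_def)
    then obtain e where e: "0 < e" "ball m e \<subseteq> hyp_plane"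
      by (metis hyp_plane_def open_ball open_contains_ball)
    obtain v v' where v: "norm v < e" "norm v' < e"
      "side a b (m - v) < 0" "side a b (m - v') < 0" "side a b (m + v') > 0" "side a b (m + v) > 0"
      "side c d (m - v) < 0" "side c d (m - v') > 0" "side c d (m + v') < 0" "side c d (m + v) > 0"
      using crossing_quadrants [OF ab cd m [unfolded g h] e(1)] by metis
    \<comment> \<open>The multipliers \<open>s\<close> and \<open>t\<close>, each 1 or -1, treat the
      four sectors at once.\<close>
    have *: "\<exists>q\<in>?D. 0 < s * side a b q \<and> 0 < t * side c d q"
      if "norm u < e" "0 < s * side a b (m + u)" "0 < t * side c d (m + u)" for s t u
    proof -
      have "open (ball m e \<inter> {q. 0 < s * side a b q} \<inter> {q. 0 < t * side c d q})"
        by (intro open_Int open_Collect_less continuous_intros) auto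
      moreover have "m + u \<in> ball m e \<inter> {q. 0 < s * side a b q} \<inter> {q. 0 < t * side c d q}"
        using that by (simp add: dist_norm)
      ultimately show ?thesis using D(2) e(2) by blast
    qed
    obtain x where x: "x \<in> ?D" "side a b x < 0" "side c d x < 0"
      using * [of "- v" "-1" "-1"] v by auto
    obtain y where y: "y \<in> ?D" "side a b y < 0" "side c d y > 0"
      using * [of "- v'" "-1" 1] v by auto
    obtain z where z: "z \<in> ?D" "side a b z > 0" "side c d z < 0"
      using * [of v' 1 "-1"] v by auto
    obtain w where w: "w \<in> ?D" "side a b w > 0" "side c d w > 0"
      using * [of v 1 1] v by auto
    have "g \<in> separating x y z w" "h \<in> separating x z y w"
      unfolding g h using ab cd x y z w by (auto intro!: separatingI)
    then show "(g, h) \<in> (\<Union>x\<in>?D. \<Union>y\<in>?D. \<Union>z\<in>?D. \<Union>w\<in>?D. separating x y z w \<times> separating x z y w)"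
      using x(1) y(1) z(1) w(1) by blast
  qed
  moreover have "(\<Union>x\<in>?D. \<Union>y\<in>?D. \<Union>z\<in>?D. \<Union>w\<in>?D. separating x y z w \<times> separating x z y w) \<subseteq> transverse_pairs"
    using separating_transverse by blast
  ultimately show thesis
    using D(1) by (intro that [of ?D]) auto
qed


subsection \<open>The intersection number\<close>

context current
begin

lemma separating_measurable: "separating x y z w \<in> sets \<mu>"
  by (rule open_measurable [OF openin_separating])

lemma transverse_pairs_measurable: "transverse_pairs \<in> sets (\<mu> \<Otimes>\<^sub>M \<mu>)"
proof -
  obtain D where D: "countable D"
    "transverse_pairs = (\<Union>x\<in>D. \<Union>y\<in>D. \<Union>z\<in>D. \<Union>w\<in>D. separating x y z w \<times> separating x z y w)"
    by (rule transverse_pairs_countable_cover)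
  show ?thesis
    unfolding D(2)
    by (intro sets.countable_UN'' D(1) pair_measureI separating_measurable)
qed

text \<open>Transversals in the sense of orbit representatives, at most one per orbit; unrelated to
  \<open>transversals\<close>.\<close>

definition partial_transversals ::
  "(complex set \<times> complex set) set set \<Rightarrow> (complex set \<times> complex set) set set" where
  "partial_transversals B = {U \<in> sets (\<mu> \<Otimes>\<^sub>M \<mu>). U \<subseteq> \<Union>B \<and>
     (\<forall>u\<in>U. \<forall>v\<in>U. (u, v) \<in> transverse_orbit_rel p \<longrightarrow> u = v)}"

definition orbit_mass :: "(complex set \<times> complex set) set set \<Rightarrow> ennreal" where
  "orbit_mass B = (SUP U\<in>partial_transversals B. emeasure (\<mu> \<Otimes>\<^sub>M \<mu>) U)"

abbreviation orbits :: "(complex set \<times> complex set) set set" where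
  "orbits \<equiv> transverse_pairs // transverse_orbit_rel p"

definition orbit_sets :: "(complex set \<times> complex set) set set set" where
  "orbit_sets = {B. B \<subseteq> orbits \<and> \<Union>B \<in> sets (\<mu> \<Otimes>\<^sub>M \<mu>)}"

lemma empty_partial_transversal: "{} \<in> partial_transversals B"
  by (simp add: partial_transversals_def)

lemma orbit_mass_mono:
  assumes "B \<subseteq> C"
  shows "orbit_mass B \<le> orbit_mass C"
proof -
  have "U \<in> partial_transversals C" if "U \<in> partial_transversals B" for U
    using that order_trans [of U "\<Union>B" "\<Union>C"] Union_mono [OF assms] by (simp add: partial_transversals_def)
  then show ?thesis
    unfolding orbit_mass_def by (intro SUP_subset_mono subsetI order_refl)
qed

lemma Union_orbits: "\<Union>orbits = transverse_pairs"
  by (rule Union_quotient [OF equiv_transverse_orbit_rel])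

lemma orbit_eqI:
  assumes "b \<in> orbits" "c \<in> orbits" "u \<in> b" "v \<in> c" "u = v \<or> (u, v) \<in> transverse_orbit_rel p"
  shows "b = c"
proof -
  have "(u, v) \<in> transverse_orbit_rel p"
    using assms equiv_transverse_orbit_rel [of p] Union_orbits
    by (metis UnionI equivE refl_onD)
  then show ?thesis
    using quotient_eqI [OF equiv_transverse_orbit_rel assms(1,2,3,4)] by blast
qed

text \<open>Distinct orbits are disjoint, so complements among orbits become complements of their
  unions within \<open>transverse_pairs\<close>.\<close>

lemma orbit_sets_algebra: "sigma_algebra orbits orbit_sets"
  unfolding sigma_algebra_iff2
proof (intro conjI ballI allI impI)
  show "orbit_sets \<subseteq> Pow orbits" "{} \<in> orbit_sets"
    by (auto simp: orbit_sets_def)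
  show "orbits - B \<in> orbit_sets" if "B \<in> orbit_sets" for B
  proof -
    have B: "B \<subseteq> orbits" using that by (simp add: orbit_sets_def)
    have "\<Union>(orbits - B) = transverse_pairs - \<Union>B"
    proof (intro equalityI subsetI)
      fix u assume "u \<in> \<Union>(orbits - B)"
      then obtain b where b: "b \<in> orbits" "b \<notin> B" "u \<in> b" by blast
      then have "u \<notin> \<Union>B" using B orbit_eqI by blast
      then show "u \<in> transverse_pairs - \<Union>B" using b Union_orbits by blast
    next
      fix u assume "u \<in> transverse_pairs - \<Union>B"
      then show "u \<in> \<Union>(orbits - B)" using Union_orbits by blast
    qed
    then show ?thesis
      using that transverse_pairs_measurable by (auto simp: orbit_sets_def)
  qed
  show "(\<Union>i. B i) \<in> orbit_sets" if "range B \<subseteq> orbit_sets" for B :: "nat \<Rightarrow> _"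
  proof -
    have "\<Union>(\<Union>i. B i) = (\<Union>i. \<Union>(B i))" by blast
    also have "\<dots> \<in> sets (\<mu> \<Otimes>\<^sub>M \<mu>)"
      using that by (intro sets.countable_UN) (auto simp: orbit_sets_def)
    finally show ?thesis using that by (auto simp: orbit_sets_def)
  qed
qed

text \<open>Partial transversals over disjoint sets of orbits can be united without representing any
  orbit twice. The empty transversal makes both suprema nonempty, so addition commutes with
  them.\<close>

lemma orbit_mass_superadditive:
  assumes BC: "B \<subseteq> orbits" "C \<subseteq> orbits" "B \<inter> C = {}"
  shows "orbit_mass B + orbit_mass C \<le> orbit_mass (B \<union> C)"
proof -
  let ?m = "emeasure (\<mu> \<Otimes>\<^sub>M \<mu>)"
  have le: "?m U + ?m V \<le> orbit_mass (B \<union> C)"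
    if U: "U \<in> partial_transversals B" and V: "V \<in> partial_transversals C" for U V
  proof -
    have "u = v" if "u \<in> U \<union> V" "v \<in> U \<union> V" and uv: "(u, v) \<in> transverse_orbit_rel p" for u v
    proof -
      obtain b c where bc: "b \<in> B \<union> C" "c \<in> B \<union> C" "u \<in> b" "v \<in> c"
        "b \<in> B \<longleftrightarrow> u \<in> U" "c \<in> B \<longleftrightarrow> v \<in> U"
      proof -
        have *: "\<exists>b\<in>B \<union> C. w \<in> b \<and> (b \<in> B \<longleftrightarrow> w \<in> U)" if "w \<in> U \<union> V" for w
        proof (cases "w \<in> U")
          case True
          then show ?thesis using U by (auto simp: partial_transversals_def)
        next
          case False
          then have "w \<in> V" using that by simp
          then obtain c where "c \<in> C" "w \<in> c" using V by (auto simp: partial_transversals_def)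
          then show ?thesis using False BC by blast
        qed
        show thesis using * \<open>u \<in> U \<union> V\<close> \<open>v \<in> U \<union> V\<close> that by meson
      qed
      have "b = c" using orbit_eqI [of b c u v] bc uv BC by blast
      then have "u \<in> U \<and> v \<in> U \<or> u \<in> V \<and> v \<in> V" using bc that by blast
      then show ?thesis using U V uv by (auto simp: partial_transversals_def)
    qed
    then have "U \<union> V \<in> partial_transversals (B \<union> C)"
      using U V by (auto simp: partial_transversals_def)
    moreover have "U \<inter> V = {}"
    proof (rule ccontr)
      assume "U \<inter> V \<noteq> {}"
      then obtain u where "u \<in> U" "u \<in> V" by blast
      moreover have "U \<subseteq> \<Union>B" "V \<subseteq> \<Union>C"
        using U V by (simp_all add: partial_transversals_def)
      ultimately obtain b c where "u \<in> b" "u \<in> c" "b \<in> B" "c \<in> C" by blast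
      then show False using orbit_eqI [of b c u u] BC by blast
    qed
    then have "?m (U \<union> V) = ?m U + ?m V"
      using U V by (intro plus_emeasure [symmetric]) (auto simp: partial_transversals_def)
    ultimately show ?thesis
      unfolding orbit_mass_def by (metis SUP_upper)
  qed
  have "orbit_mass B + ?m V \<le> orbit_mass (B \<union> C)" if V: "V \<in> partial_transversals C" for V
  proof -
    have "orbit_mass B + ?m V = (SUP U\<in>partial_transversals B. ?m U + ?m V)"
      unfolding orbit_mass_def using empty_partial_transversal
      by (subst ennreal_SUP_add_left) auto
    also have "\<dots> \<le> orbit_mass (B \<union> C)" using le V by (intro SUP_least) auto
    finally show ?thesis .
  qed
  then have "(SUP V\<in>partial_transversals C. orbit_mass B + ?m V) \<le> orbit_mass (B \<union> C)"
    by (rule SUP_least)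
  moreover have "(SUP V\<in>partial_transversals C. orbit_mass B + ?m V) = orbit_mass B + orbit_mass C"
    unfolding orbit_mass_def [of C] using empty_partial_transversal
    by (subst ennreal_SUP_add_right) auto
  ultimately show ?thesis by simp
qed

text \<open>One inequality is finite superadditivity and monotonicity. For the other, a transversal
  of the union is cut along the saturated sets \<open>\<Union>(B i)\<close> into transversals of the
  pieces.\<close>

lemma orbit_mass_countably_additive: "countably_additive orbit_sets orbit_mass"
  unfolding countably_additive_def
proof (intro allI impI antisym)
  fix B :: "nat \<Rightarrow> (complex set \<times> complex set) set set"
  assume range: "range B \<subseteq> orbit_sets" and disj: "disjoint_family B" and "\<Union>(range B) \<in> orbit_sets"
  have B: "B i \<subseteq> orbits" "\<Union>(B i) \<in> sets (\<mu> \<Otimes>\<^sub>M \<mu>)" for i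
    using range by (auto simp: orbit_sets_def)
  have "(\<Sum>i<n. orbit_mass (B i)) \<le> orbit_mass (\<Union>i<n. B i)" for n
  proof (induction n)
    case (Suc n)
    have "(\<Sum>i<Suc n. orbit_mass (B i)) \<le> orbit_mass (\<Union>i<n. B i) + orbit_mass (B n)"
      using Suc by (simp add: add_right_mono)
    also have "\<dots> \<le> orbit_mass ((\<Union>i<n. B i) \<union> B n)"
    proof (rule orbit_mass_superadditive)
      have "B i \<inter> B n = {}" if "i < n" for i
        using disjoint_family_onD [OF disj, of i n] that by simp
      then show "(\<Union>i<n. B i) \<inter> B n = {}" by blast
    qed (use B in auto)
    also have "(\<Union>i<n. B i) \<union> B n = (\<Union>i<Suc n. B i)" by (auto simp: less_Suc_eq)
    finally show ?case .
  qed simp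
  then have "(\<Sum>i<n. orbit_mass (B i)) \<le> orbit_mass (\<Union>(range B))" for n
    by (rule order_trans) (auto intro: orbit_mass_mono)
  then show "(\<Sum>i. orbit_mass (B i)) \<le> orbit_mass (\<Union>(range B))"
    by (intro suminf_le_const summableI)
  show "orbit_mass (\<Union>(range B)) \<le> (\<Sum>i. orbit_mass (B i))"
    unfolding orbit_mass_def [of "\<Union>(range B)"]
  proof (rule SUP_least)
    fix U assume U: "U \<in> partial_transversals (\<Union>(range B))"
    have UB: "U \<inter> \<Union>(B i) \<in> partial_transversals (B i)" for i
      using U B by (auto simp: partial_transversals_def)
    have "disjoint_family (\<lambda>i. U \<inter> \<Union>(B i))"
      unfolding disjoint_family_on_def
    proof (intro ballI impI equals0I)
      fix i j u assume "i \<noteq> j" "u \<in> (U \<inter> \<Union>(B i)) \<inter> (U \<inter> \<Union>(B j))"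
      then obtain b c where "b \<in> B i" "c \<in> B j" "u \<in> b" "u \<in> c" by blast
      moreover from this have "b = c" using orbit_eqI [of b c u u] B by blast
      ultimately show False using disjoint_family_onD [OF disj, of i j] \<open>i \<noteq> j\<close> by blast
    qed
    then have "(\<Sum>i. emeasure (\<mu> \<Otimes>\<^sub>M \<mu>) (U \<inter> \<Union>(B i))) = emeasure (\<mu> \<Otimes>\<^sub>M \<mu>) (\<Union>i. U \<inter> \<Union>(B i))"
      using UB by (intro suminf_emeasure) (auto simp: partial_transversals_def)
    also have "(\<Union>i. U \<inter> \<Union>(B i)) = U"
      using U unfolding partial_transversals_def by blast
    finally have "emeasure (\<mu> \<Otimes>\<^sub>M \<mu>) U = (\<Sum>i. emeasure (\<mu> \<Otimes>\<^sub>M \<mu>) (U \<inter> \<Union>(B i)))" ..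
    also have "\<dots> \<le> (\<Sum>i. orbit_mass (B i))"
      unfolding orbit_mass_def using UB by (intro suminf_le summableI SUP_upper)
    finally show "emeasure (\<mu> \<Otimes>\<^sub>M \<mu>) U \<le> (\<Sum>i. orbit_mass (B i))" .
  qed
qed

text \<open>\<open>measure_of\<close> yields the zero measure when its set function is not a
  measure, so additivity has to be established before the intersection number has its intended
  value.\<close>

lemma intersection_number_eq: "intersection_number p \<mu> \<mu> = orbit_mass orbits"
proof -
  have eq: "induced_measure p \<mu> \<mu> = measure_of orbits orbit_sets orbit_mass"
    unfolding induced_measure_def orbit_sets_def orbit_mass_def partial_transversals_def by simp
  have "partial_transversals {} = {{}}" by (auto simp: partial_transversals_def)
  then have "positive orbit_sets orbit_mass"
    by (simp add: positive_def orbit_mass_def)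
  moreover have "orbits \<in> orbit_sets"
    using transverse_pairs_measurable by (simp add: orbit_sets_def Union_orbits)
  ultimately have "emeasure (induced_measure p \<mu> \<mu>) orbits = orbit_mass orbits"
    unfolding eq
    by (intro emeasure_measure_of_sigma orbit_sets_algebra orbit_mass_countably_additive)
  then show ?thesis
    by (simp add: intersection_number_def eq space_measure_of_conv)
qed

section \<open>Crossings in the support\<close>

definition no_crossing :: bool where
  "no_crossing \<longleftrightarrow> (\<forall>(g, h) \<in> transverse_pairs. g \<in> null_open \<or> h \<in> null_open)"

lemma open_positive:
  assumes "openin geodesic_topology U" "g \<in> U" "g \<notin> null_open"
  shows "emeasure \<mu> U \<noteq> 0"
  using assms unfolding null_open_def by blast

text \<open>Pairs crossing in a small disc around a crossing point form a rectangle that meets every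
  orbit at most once, since a deck transformation identifying two of them has to fix their common
  crossing point.\<close>

lemma no_crossing_if_intersection_zero:
  assumes p: "covering_space hyp_plane p X" and zero: "intersection_number p \<mu> \<mu> = 0"
  shows no_crossing
  unfolding no_crossing_def
proof (intro ballI case_prodI2 impI, rule ccontr)
  fix gh g h assume "gh \<in> transverse_pairs" "gh = (g, h)" and null: "\<not> (g \<in> null_open \<or> h \<in> null_open)"
  then have gh: "(g, h) \<in> transverse_pairs" by simp
  obtain a b c d m where g: "g = {a, b}" and ab: "(a, b) \<in> oriented_geodesics"
    and h: "h = {c, d}" and cd: "(c, d) \<in> oriented_geodesics" and m: "chord g \<inter> chord h = {m}"
    using gh by (rule transverse_pairsE)
  have "m \<in> hyp_plane" using m by (auto simp: chord_def)
  then obtain T u q where T: "m \<in> T" "openin (top_of_set hyp_plane) T" "homeomorphism T u p q"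
    using covering_space_local_homeomorphism [OF p] by metis
  then have "open T" "T \<subseteq> hyp_plane"
    using openin_open_trans [of hyp_plane T] openin_imp_subset by (auto simp: hyp_plane_def)
  then obtain e where e: "0 < e" "ball m e \<subseteq> T"
    using T(1) open_contains_ball by blast
  \<comment> \<open>A ball is taken inside \<open>T\<close> because convexity keeps the crossing
    points of all pairs in the rectangle inside it, while \<open>p\<close> remains
    injective.\<close>
  define C where "C = ball m e"
  have "inj_on p T"
    using T(3) by (metis homeomorphism_apply1 inj_onI)
  then have C: "convex C" "open C" "C \<subseteq> hyp_plane" "inj_on p C"
    using e \<open>T \<subseteq> hyp_plane\<close> inj_on_subset [of p T C] by (simp_all add: C_def)
  obtain v v' where v: "norm v < e" "norm v' < e"
    "side a b (m - v) < 0" "side a b (m - v') < 0" "side a b (m + v') > 0" "side a b (m + v) > 0"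
    "side c d (m - v) < 0" "side c d (m - v') > 0" "side c d (m + v') < 0" "side c d (m + v) > 0"
    using crossing_quadrants [OF ab cd m [unfolded g h] e(1)] by metis
  define x y z w where "x = m - v" and "y = m - v'" and "z = m + v'" and "w = m + v"
  have pts: "x \<in> C" "y \<in> C" "z \<in> C" "w \<in> C"
    using v by (simp_all add: x_def y_def z_def w_def C_def dist_norm)
  let ?G = "separating x y z w" and ?H = "separating x z y w"
  have gG: "g \<in> ?G" and hH: "h \<in> ?H"
    unfolding g h x_def y_def z_def w_def using ab cd v by (auto intro!: separatingI)
  have "?G \<times> ?H \<in> partial_transversals orbits"
    unfolding partial_transversals_def Union_orbits
  proof (intro CollectI conjI ballI impI)
    show "?G \<times> ?H \<in> sets (\<mu> \<Otimes>\<^sub>M \<mu>)"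
      by (intro pair_measureI separating_measurable)
    show "?G \<times> ?H \<subseteq> transverse_pairs"
      using separating_transverse pts C(3) by blast
    fix s t assume s: "s \<in> ?G \<times> ?H" and t: "t \<in> ?G \<times> ?H" and st: "(s, t) \<in> transverse_orbit_rel p"
    obtain k l where kl: "s = (k, l)" "k \<in> ?G" "l \<in> ?H" using s by blast
    obtain A where A: "A \<in> deck_group p" and t_eq: "t = (proj_act A ` k, proj_act A ` l)"
      using st by (auto simp: transverse_orbit_rel_def kl)
    obtain n where n: "n \<in> C" "chord k \<inter> chord l = {n}"
      using separating_crossing [OF kl(2,3) C(1,3) pts] by blast
    obtain n' where n': "n' \<in> C" "chord (proj_act A ` k) \<inter> chord (proj_act A ` l) = {n'}"
      using separating_crossing [OF _ _ C(1,3) pts] t t_eq by blast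
    have "k \<in> geodesics" "l \<in> geodesics"
      using kl separating_geodesics by blast+
    then have "proj_act A n \<in> chord (proj_act A ` k) \<inter> chord (proj_act A ` l)"
      using n(2) proj_act_chord [OF deck_group_isometry [OF A]] by (metis IntD1 IntD2 IntI geodesicsE singletonI)
    then have "proj_act A n \<in> C" using n' by (metis singletonD)
    then have "proj_act A c = c" if "norm c \<le> 1" for c
      using deck_group_free [OF A C(2,3,4) n(1)] that by blast
    then have "proj_act A ` f = f" if "f \<in> geodesics" for f
      using that by (auto simp: geodesics_def hyp_boundary_def)
    then show "s = t"
      using \<open>k \<in> geodesics\<close> \<open>l \<in> geodesics\<close> by (simp add: kl(1) t_eq)
  qed
  then have "emeasure (\<mu> \<Otimes>\<^sub>M \<mu>) (?G \<times> ?H) \<le> 0"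
    unfolding zero [symmetric] intersection_number_eq orbit_mass_def by (rule SUP_upper)
  \<comment> \<open>The mass of a rectangle is a product, so one factor vanishes, although both are
    neighbourhoods of geodesics in the support.\<close>
  then have "emeasure \<mu> ?G * emeasure \<mu> ?H = 0"
    using sigma_finite_measure.emeasure_pair_measure_Times [OF sigma_finite separating_measurable separating_measurable]
    by simp
  then show False
    using open_positive [OF openin_separating gG] open_positive [OF openin_separating hH] null by simp
qed

text \<open>All transverse pairs lie in two rectangles with a null side, which are null by
  sigma-finiteness.\<close>

lemma intersection_zero_if_no_crossing:
  assumes no_crossing
  shows "intersection_number p \<mu> \<mu> = 0"
proof -
  interpret sigma_finite_measure \<mu> by (rule sigma_finite)
  have top: "geodesics \<in> sets \<mu>" using sets.top [of \<mu>] by (simp add: space_current)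
  let ?N = "null_open \<times> geodesics \<union> geodesics \<times> null_open"
  have null: "?N \<in> null_sets (\<mu> \<Otimes>\<^sub>M \<mu>)"
    using null_open_null top by (intro null_sets.Un times_in_null_sets1 times_in_null_sets2)
  have "transverse_pairs \<subseteq> ?N"
    using assms by (auto simp: no_crossing_def transverse_pairs_def)
  then have "emeasure (\<mu> \<Otimes>\<^sub>M \<mu>) U = 0" if "U \<in> partial_transversals orbits" for U
    using that null_sets_subset [OF null, of U] by (auto simp: partial_transversals_def Union_orbits)
  then have "orbit_mass orbits \<le> 0"
    unfolding orbit_mass_def by (intro SUP_least) simp
  then show ?thesis
    by (simp add: intersection_number_eq)
qed

end


subsection \<open>The four-point condition for one geodesic\<close>

text \<open>The weak counterpart of \<open>separating\<close>: the geodesic may pass through some of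
  the points, as long as a gap remains between the signs of the two pairs.\<close>

definition splits :: "complex \<Rightarrow> complex \<Rightarrow> complex \<Rightarrow> complex \<Rightarrow> complex set \<Rightarrow> bool" where
  "splits x y z w g \<longleftrightarrow>
     weight x y g + weight z w g < weight x z g + weight y w g \<and>
     weight x y g + weight z w g < weight y z g + weight x w g"

lemma weight_commute: "weight x y = weight y x"
  by (simp add: weight_def fun_eq_iff closed_segment_commute [of x y] add.commute)

lemma splits_swap: "splits x y z w = splits y x z w"
  by (auto simp: splits_def fun_eq_iff weight_commute add.commute)

text \<open>Among the three pairings of four reals, one has a strictly smallest sum only if its two
  pairs span disjoint intervals.\<close>

lemma four_real_gap:
  fixes p q r s :: real
  assumes "\<bar>p - q\<bar> + \<bar>r - s\<bar> < \<bar>p - r\<bar> + \<bar>q - s\<bar>" "\<bar>p - q\<bar> + \<bar>r - s\<bar> < \<bar>q - r\<bar> + \<bar>p - s\<bar>"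
  shows "max p q < min r s \<or> max r s < min p q"
  using assms by (smt (verit, best))

text \<open>The real line is itself 0-hyperbolic.\<close>

lemma four_real_cases:
  fixes p q r s :: real
  defines "D1 \<equiv> \<bar>p - q\<bar> + \<bar>r - s\<bar>" and "D2 \<equiv> \<bar>p - r\<bar> + \<bar>q - s\<bar>" and "D3 \<equiv> \<bar>q - r\<bar> + \<bar>p - s\<bar>"
  shows "D1 = D2 \<and> D3 \<le> D1 \<or> D1 = D3 \<and> D2 \<le> D1 \<or> D2 = D3 \<and> D1 \<le> D2"
  unfolding D1_def D2_def D3_def by (smt (verit, best))

lemma splits_orientation:
  assumes g: "g \<in> geodesics" and "x \<in> hyp_plane" "y \<in> hyp_plane" "z \<in> hyp_plane" "w \<in> hyp_plane"
    and s: "splits x y z w g"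
  obtains a b where "g = {a, b}" "(a, b) \<in> oriented_geodesics"
    "max (sgn (side a b x)) (sgn (side a b y)) < min (sgn (side a b z)) (sgn (side a b w))"
proof -
  obtain a b where ab: "g = {a, b}" "(a, b) \<in> oriented_geodesics"
    using g by (rule geodesicsE)
  have "max (sgn (side a b x)) (sgn (side a b y)) < min (sgn (side a b z)) (sgn (side a b w)) \<or>
      max (sgn (side a b z)) (sgn (side a b w)) < min (sgn (side a b x)) (sgn (side a b y))"
    using s assms ab by (intro four_real_gap) (simp_all add: splits_def weight_eq)
  then show thesis
  proof
    assume "max (sgn (side a b z)) (sgn (side a b w)) < min (sgn (side a b x)) (sgn (side a b y))"
    then have "max (sgn (side b a x)) (sgn (side b a y)) < min (sgn (side b a z)) (sgn (side b a w))"
      by (simp add: side_swap [of b a] sgn_minus)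
    then show thesis using that [of b a] ab oriented_geodesics_swap by auto
  qed (use that ab in blast)
qed

lemma splits_crossing:
  assumes "g \<in> geodesics" "h \<in> geodesics"
    and P: "x \<in> hyp_plane" "y \<in> hyp_plane" "z \<in> hyp_plane" "w \<in> hyp_plane"
    and "splits x y z w g" "splits x z y w h"
  shows "(g, h) \<in> transverse_pairs"
proof -
  obtain a b where ab: "g = {a, b}" "(a, b) \<in> oriented_geodesics"
    "max (sgn (side a b x)) (sgn (side a b y)) < min (sgn (side a b z)) (sgn (side a b w))"
    using splits_orientation assms by metis
  obtain c d where cd: "h = {c, d}" "(c, d) \<in> oriented_geodesics"
    "max (sgn (side c d x)) (sgn (side c d z)) < min (sgn (side c d y)) (sgn (side c d w))"
    using splits_orientation assms by metis
  show ?thesis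
    using crossing [OF ab(2) cd(2) convex_hyp_plane order_refl P ab(3) cd(3)] assms(1,2)
    by (auto simp: transverse_pairs_def ab(1) cd(1))
qed

lemma weight_four_points:
  assumes "g \<in> geodesics" and "x \<in> hyp_plane" "y \<in> hyp_plane" "z \<in> hyp_plane" "w \<in> hyp_plane"
  defines "F1 \<equiv> weight x y g + weight z w g" and "F2 \<equiv> weight x z g + weight y w g"
    and "F3 \<equiv> weight y z g + weight x w g"
  shows "F1 = F2 \<and> F3 \<le> F1 \<or> F1 = F3 \<and> F2 \<le> F1 \<or> F2 = F3 \<and> F1 \<le> F2"
proof -
  obtain a b where ab: "g = {a, b}" "(a, b) \<in> oriented_geodesics"
    using assms(1) by (rule geodesicsE)
  define s where "s q = sgn (side a b q)" for q
  have "F1 = (\<bar>s x - s y\<bar> + \<bar>s z - s w\<bar>) / 2" "F2 = (\<bar>s x - s z\<bar> + \<bar>s y - s w\<bar>) / 2"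
    "F3 = (\<bar>s y - s z\<bar> + \<bar>s x - s w\<bar>) / 2"
    unfolding F1_def F2_def F3_def ab(1) using assms(2-5)
    by (simp_all add: weight_eq [OF ab(2)] add_divide_distrib s_def)
  then show ?thesis
    using four_real_cases [of "s x" "s y" "s z" "s w"] by argo
qed

text \<open>No geodesic splits the pair of diagonals of a parallelogram, because they intersect.\<close>

lemma diagonals_dominate:
  assumes g: "g \<in> geodesics"
    and P: "m - v \<in> hyp_plane" "m - v' \<in> hyp_plane" "m + v' \<in> hyp_plane" "m + v \<in> hyp_plane"
  defines "F1 \<equiv> weight (m - v) (m - v') g + weight (m + v') (m + v) g"
    and "F2 \<equiv> weight (m - v) (m + v') g + weight (m - v') (m + v) g"
    and "F3 \<equiv> weight (m - v') (m + v') g + weight (m - v) (m + v) g"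
  shows "F1 \<le> F3" "F2 \<le> F3"
proof -
  have "\<not> splits (m - v') (m + v') (m - v) (m + v) g"
  proof
    assume "splits (m - v') (m + v') (m - v) (m + v) g"
    then obtain a b where G: "max (sgn (side a b (m - v'))) (sgn (side a b (m + v'))) <
        min (sgn (side a b (m - v))) (sgn (side a b (m + v)))"
      using splits_orientation [OF g P(2,3,1,4)] by metis
    \<comment> \<open>Both sums are twice the value at the centre \<open>m\<close>, whereas the gap
      would make the first one smaller.\<close>
    have "side a b (m - v') + side a b (m + v') = side a b (m - v) + side a b (m + v)"
      by (simp add: side_def algebra_simps)
    then show False using G by (auto simp: sgn_if split: if_splits)
  qed
  then show "F1 \<le> F3" "F2 \<le> F3"
    using weight_four_points [OF g P] unfolding splits_def F1_def F2_def F3_def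
    by (auto simp: weight_commute)
qed


subsection \<open>The dual space\<close>

context current
begin

section \<open>The pseudometric and its quotient\<close>

lemma dual_pseudodist_nonneg: "0 \<le> dual_pseudodist \<mu> x y"
  by (simp add: dual_pseudodist_def)

lemma dual_pseudodist_commute: "dual_pseudodist \<mu> x y = dual_pseudodist \<mu> y x"
  by (simp add: dual_pseudodist_def closed_segment_commute [of x y] add.commute)

lemma dual_pseudodist_self: "dual_pseudodist \<mu> x x = 0"
  by (simp add: dual_pseudodist_def transversals_def)

lemma dual_pseudodist_triangle:
  assumes "x \<in> hyp_plane" "y \<in> hyp_plane" "z \<in> hyp_plane"
  shows "dual_pseudodist \<mu> x z \<le> dual_pseudodist \<mu> x y + dual_pseudodist \<mu> y z"
proof -
  have "weight x z g \<le> weight x y g + weight y z g" if g: "g \<in> geodesics" for g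
  proof -
    obtain a b where "g = {a, b}" "(a, b) \<in> oriented_geodesics"
      using g by (rule geodesicsE)
    then show ?thesis
      using assms by (simp add: weight_eq add_divide_distrib [symmetric])
  qed
  then have "(LINT g|\<mu>. weight x z g) \<le> (LINT g|\<mu>. weight x y g + weight y z g)"
    using assms by (intro integral_mono Bochner_Integration.integrable_add integrable_weight) (simp_all add: space_current)
  then show ?thesis
    using assms by (simp add: dual_pseudodist_eq_integral integrable_weight)
qed

definition dual_rel :: "(complex \<times> complex) set" where
  "dual_rel = {(x, y). x \<in> hyp_plane \<and> y \<in> hyp_plane \<and> dual_pseudodist \<mu> x y = 0}"

lemma equiv_dual_rel: "equiv hyp_plane dual_rel"
proof (rule equivI)
  show "trans dual_rel"
  proof (rule transI)
    fix x y z assume "(x, y) \<in> dual_rel" "(y, z) \<in> dual_rel"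
    then show "(x, z) \<in> dual_rel"
      using dual_pseudodist_triangle [of x y z] dual_pseudodist_nonneg [of x z] by (simp add: dual_rel_def)
  qed
qed (auto simp: dual_rel_def refl_on_def sym_def dual_pseudodist_self dual_pseudodist_commute)

lemma dual_space_eq: "dual_space \<mu> = hyp_plane // dual_rel"
  by (simp add: dual_space_def dual_rel_def)

lemma dual_space_representative:
  assumes "X \<in> dual_space \<mu>"
  shows "(SOME x. x \<in> X) \<in> X" "(SOME x. x \<in> X) \<in> hyp_plane"
proof -
  have X: "X \<in> hyp_plane // dual_rel" using assms by (simp add: dual_space_eq)
  then have "X \<noteq> {}" by (rule in_quotient_imp_non_empty [OF equiv_dual_rel])
  then show "(SOME x. x \<in> X) \<in> X" by (simp add: some_in_eq)
  then show "(SOME x. x \<in> X) \<in> hyp_plane"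
    using in_quotient_imp_subset [OF equiv_dual_rel X] by blast
qed

lemma dual_dist_zero_iff:
  assumes X: "X \<in> dual_space \<mu>" and Y: "Y \<in> dual_space \<mu>"
  shows "dual_dist \<mu> X Y = 0 \<longleftrightarrow> X = Y"
  using quotient_eq_iff [OF equiv_dual_rel X [unfolded dual_space_eq] Y [unfolded dual_space_eq]
      dual_space_representative(1) [OF X] dual_space_representative(1) [OF Y]]
    dual_space_representative(2) [OF X] dual_space_representative(2) [OF Y]
  by (simp add: dual_dist_def dual_rel_def)

lemma Metric_space_dual: "Metric_space (dual_space \<mu>) (dual_dist \<mu>)"
proof
  show "0 \<le> dual_dist \<mu> X Y" "dual_dist \<mu> X Y = dual_dist \<mu> Y X" for X Y
    unfolding dual_dist_def by (rule dual_pseudodist_nonneg, rule dual_pseudodist_commute)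
  show "dual_dist \<mu> X Y = 0 \<longleftrightarrow> X = Y" if "X \<in> dual_space \<mu>" "Y \<in> dual_space \<mu>" for X Y
    using that by (rule dual_dist_zero_iff)
  show "dual_dist \<mu> X Z \<le> dual_dist \<mu> X Y + dual_dist \<mu> Y Z"
    if "X \<in> dual_space \<mu>" "Y \<in> dual_space \<mu>" "Z \<in> dual_space \<mu>" for X Y Z
    unfolding dual_dist_def using that by (intro dual_pseudodist_triangle dual_space_representative)
qed

definition point_class :: "complex \<Rightarrow> complex set" where
  "point_class x = dual_rel `` {x}"

lemma point_class_in: "x \<in> hyp_plane \<Longrightarrow> point_class x \<in> dual_space \<mu>"
  by (simp add: point_class_def dual_space_eq quotientI)

text \<open>Moving to another representative costs distance 0, so the triangle inequality in both
  directions removes the dependence on \<open>SOME\<close>.\<close>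

lemma dual_dist_point_class:
  assumes x: "x \<in> hyp_plane" and y: "y \<in> hyp_plane"
  shows "dual_dist \<mu> (point_class x) (point_class y) = dual_pseudodist \<mu> x y"
proof -
  define x' y' where "x' = (SOME u. u \<in> point_class x)" and "y' = (SOME u. u \<in> point_class y)"
  have "x' \<in> point_class x" "y' \<in> point_class y"
    unfolding x'_def y'_def using x y by (simp_all add: point_class_in dual_space_representative)
  then have *: "x' \<in> hyp_plane" "y' \<in> hyp_plane" "dual_pseudodist \<mu> x x' = 0" "dual_pseudodist \<mu> y y' = 0"
    by (auto simp: point_class_def dual_rel_def)
  then have "dual_pseudodist \<mu> x' y' = dual_pseudodist \<mu> x y"
    using x y dual_pseudodist_triangle [of x x' y] dual_pseudodist_triangle [of x' y' y]
      dual_pseudodist_triangle [of x' x y'] dual_pseudodist_triangle [of x y y']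
    by (simp add: dual_pseudodist_commute [of y' y] dual_pseudodist_commute [of x' x])
  then show ?thesis by (simp add: dual_dist_def x'_def y'_def)
qed

section \<open>The four-point condition and crossings\<close>

definition four_points :: "complex \<Rightarrow> complex \<Rightarrow> complex \<Rightarrow> complex \<Rightarrow> bool" where
  "four_points x y z w \<longleftrightarrow> max_attained_twice
     (dual_pseudodist \<mu> x y + dual_pseudodist \<mu> z w)
     (dual_pseudodist \<mu> x z + dual_pseudodist \<mu> y w)
     (dual_pseudodist \<mu> y z + dual_pseudodist \<mu> x w)"

lemma zero_hyperbolic_dual_iff:
  "zero_hyperbolic (dual_space \<mu>) (dual_dist \<mu>) \<longleftrightarrow>
     (\<forall>x\<in>hyp_plane. \<forall>y\<in>hyp_plane. \<forall>z\<in>hyp_plane. \<forall>w\<in>hyp_plane. four_points x y z w)"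
proof (intro iffI ballI)
  fix x y z w
  assume "zero_hyperbolic (dual_space \<mu>) (dual_dist \<mu>)"
    and P: "x \<in> hyp_plane" "y \<in> hyp_plane" "z \<in> hyp_plane" "w \<in> hyp_plane"
  then show "four_points x y z w"
    using P [THEN point_class_in] unfolding zero_hyperbolic_def four_points_def
    by (metis (no_types, lifting) dual_dist_point_class)
next
  assume "\<forall>x\<in>hyp_plane. \<forall>y\<in>hyp_plane. \<forall>z\<in>hyp_plane. \<forall>w\<in>hyp_plane. four_points x y z w"
  then show "zero_hyperbolic (dual_space \<mu>) (dual_dist \<mu>)"
    unfolding zero_hyperbolic_def four_points_def dual_dist_def
    using Metric_space_dual dual_space_representative(2) by (auto simp: dual_dist_def [abs_def])
qed

lemma integrable_weight_sum:
  assumes "x \<in> hyp_plane" "y \<in> hyp_plane" "z \<in> hyp_plane" "w \<in> hyp_plane"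
  shows "integrable \<mu> (\<lambda>g. weight x y g + weight z w g)"
    and "(LINT g|\<mu>. weight x y g + weight z w g) = dual_pseudodist \<mu> x y + dual_pseudodist \<mu> z w"
  using assms by (simp_all add: integrable_weight dual_pseudodist_eq_integral)

lemma four_points_if_no_crossing:
  assumes no_crossing and P: "x \<in> hyp_plane" "y \<in> hyp_plane" "z \<in> hyp_plane" "w \<in> hyp_plane"
  shows "four_points x y z w"
proof -
  define F1 where "F1 g = weight x y g + weight z w g" for g
  define F2 where "F2 g = weight x z g + weight y w g" for g
  define F3 where "F3 g = weight y z g + weight x w g" for g
  have int: "integrable \<mu> F1" "integrable \<mu> F2" "integrable \<mu> F3"
    unfolding F1_def F2_def F3_def using P by (auto intro: integrable_weight_sum)
  have eq: "(LINT g|\<mu>. F1 g) = dual_pseudodist \<mu> x y + dual_pseudodist \<mu> z w"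
    "(LINT g|\<mu>. F2 g) = dual_pseudodist \<mu> x z + dual_pseudodist \<mu> y w"
    "(LINT g|\<mu>. F3 g) = dual_pseudodist \<mu> y z + dual_pseudodist \<mu> x w"
    unfolding F1_def F2_def F3_def using P by (simp_all add: integrable_weight_sum)
  let ?S = "geodesics - null_open"
  have AE: "AE g in \<mu>. g \<in> ?S"
    using AE_not_in [OF null_open_null] AE_space by eventually_elim (simp add: space_current)
  have cases: "F1 g = F2 g \<and> F3 g \<le> F1 g \<or> F1 g = F3 g \<and> F2 g \<le> F1 g \<or> F2 g = F3 g \<and> F1 g \<le> F2 g"
    if "g \<in> ?S" for g
    using weight_four_points [OF _ P, of g] that by (simp add: F1_def F2_def F3_def)
  have sp: "splits x y z w g \<longleftrightarrow> F1 g < F2 g \<and> F1 g < F3 g" "splits x z y w g \<longleftrightarrow> F2 g < F1 g \<and> F2 g < F3 g"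
    "splits y z x w g \<longleftrightarrow> F3 g < F1 g \<and> F3 g < F2 g" for g
    by (auto simp: splits_def F1_def F2_def F3_def weight_commute)
  have not_both: False if "g \<in> ?S" "h \<in> ?S" "(g, h) \<in> transverse_pairs" for g h
    using assms(1) that by (auto simp: no_crossing_def)
  \<comment> \<open>The three exclusions are one statement up to relabelling the points, since any
    two pairings of four points are related like the first two.\<close>
  have "\<not> (splits x y z w g \<and> splits x z y w h)" if "g \<in> ?S" "h \<in> ?S" for g h
    using not_both that splits_crossing [OF _ _ P(1,2,3,4), of g h] by blast
  moreover have "\<not> (splits x y z w g \<and> splits y z x w h)" if "g \<in> ?S" "h \<in> ?S" for g h
    using not_both that splits_crossing [OF _ _ P(2,1,3,4), of g h] splits_swap [of x y z w] by auto
  moreover have "\<not> (splits x z y w g \<and> splits y z x w h)" if "g \<in> ?S" "h \<in> ?S" for g h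
    using not_both that splits_crossing [OF _ _ P(3,1,2,4), of g h] splits_swap [of x z y w]
      splits_swap [of z y x w] by auto
  \<comment> \<open>The exclusions hold for different geodesics \<open>g\<close> and
    \<open>h\<close> too, so one and the same type of splitting is the only possible one throughout
    the support.\<close>
  ultimately have split_free: "(\<forall>g\<in>?S. \<not> splits x y z w g \<and> \<not> splits x z y w g) \<or>
      (\<forall>g\<in>?S. \<not> splits x y z w g \<and> \<not> splits y z x w g) \<or>
      (\<forall>g\<in>?S. \<not> splits x z y w g \<and> \<not> splits y z x w g)"
    by metis
  have by12: "F1 g = F2 g \<and> F3 g \<le> F1 g"
    if "g \<in> ?S" "\<not> splits x y z w g \<and> \<not> splits x z y w g" for g
    using cases [OF that(1)] that(2) unfolding sp by argo
  have by13: "F1 g = F3 g \<and> F2 g \<le> F1 g"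
    if "g \<in> ?S" "\<not> splits x y z w g \<and> \<not> splits y z x w g" for g
    using cases [OF that(1)] that(2) unfolding sp by argo
  have by23: "F2 g = F3 g \<and> F1 g \<le> F2 g"
    if "g \<in> ?S" "\<not> splits x z y w g \<and> \<not> splits y z x w g" for g
    using cases [OF that(1)] that(2) unfolding sp by argo
  from split_free consider "\<And>g. g \<in> ?S \<Longrightarrow> F1 g = F2 g \<and> F3 g \<le> F1 g"
    | "\<And>g. g \<in> ?S \<Longrightarrow> F1 g = F3 g \<and> F2 g \<le> F1 g"
    | "\<And>g. g \<in> ?S \<Longrightarrow> F2 g = F3 g \<and> F1 g \<le> F2 g"
    using by12 by13 by23 by blast
  \<comment> \<open>The pointwise equality of the two larger sums involves the same two sums on the
    whole support, so it survives integration.\<close>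
  moreover have "(LINT g|\<mu>. A g) = (LINT g|\<mu>. B g) \<and> (LINT g|\<mu>. C g) \<le> (LINT g|\<mu>. A g)"
    if "integrable \<mu> A" "integrable \<mu> B" "integrable \<mu> C"
      and "\<And>g. g \<in> ?S \<Longrightarrow> A g = B g \<and> C g \<le> A g" for A B C :: "complex set \<Rightarrow> real"
    using that AE
    by (intro conjI integral_cong_AE integral_mono_AE) (auto elim: eventually_mono)
  ultimately show ?thesis
    using int unfolding four_points_def eq [symmetric] max_attained_twice_def
    by cases (metis max.absorb1 max.absorb2 max.idem max.left_idem)+
qed

lemma weight_separating:
  assumes "g \<in> separating x y z w" and P: "x \<in> hyp_plane" "y \<in> hyp_plane" "z \<in> hyp_plane" "w \<in> hyp_plane"
  shows "weight x y g = 0" "weight z w g = 0" "weight x z g = 1" "weight y w g = 1" "weight y z g = 1" "weight x w g = 1"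
  using assms(1) by (rule separatingE; use P in \<open>simp add: weight_eq\<close>)+

text \<open>Equal integrals would make \<open>G - F\<close> vanish almost everywhere, so
  \<open>U\<close> would be null although it meets the support.\<close>

lemma integral_strict_mono_on_open:
  assumes F: "integrable \<mu> F" and G: "integrable \<mu> G" and le: "\<And>g. g \<in> geodesics \<Longrightarrow> F g \<le> (G g :: real)"
    and U: "openin geodesic_topology U" "g \<in> U" "g \<notin> null_open" and less: "\<And>h. h \<in> U \<Longrightarrow> F h < G h"
  shows "(LINT g|\<mu>. F g) < (LINT g|\<mu>. G g)"
proof (rule ccontr)
  assume "\<not> (LINT g|\<mu>. F g) < (LINT g|\<mu>. G g)"
  moreover have "(LINT g|\<mu>. F g) \<le> (LINT g|\<mu>. G g)"
    using F G le by (intro integral_mono) (auto simp: space_current)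
  ultimately have "(LINT g|\<mu>. G g - F g) = 0"
    using F G by simp
  moreover have "AE g in \<mu>. 0 \<le> G g - F g"
    using le by (intro AE_I2) (simp add: space_current)
  ultimately have "AE g in \<mu>. G g - F g = 0"
    using integral_nonneg_eq_0_iff_AE [of \<mu> "\<lambda>g. G g - F g"] F G by auto
  then have "AE h in \<mu>. h \<notin> U"
    by eventually_elim (use less in force)
  then have "U \<in> null_sets \<mu>"
    using AE_iff_null_sets [OF open_measurable [OF U(1)]] by blast
  then have "emeasure \<mu> U = 0" by (rule null_setsD1)
  then show False using open_positive [OF U] by simp
qed

lemma no_crossing_if_four_points:
  assumes fp: "\<And>x y z w. \<lbrakk>x \<in> hyp_plane; y \<in> hyp_plane; z \<in> hyp_plane; w \<in> hyp_plane\<rbrakk> \<Longrightarrow> four_points x y z w"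
  shows no_crossing
  unfolding no_crossing_def
proof (intro ballI case_prodI2 impI, rule ccontr)
  fix gh g h assume "gh \<in> transverse_pairs" "gh = (g, h)" and null: "\<not> (g \<in> null_open \<or> h \<in> null_open)"
  then have gh: "(g, h) \<in> transverse_pairs" by simp
  obtain a b c d m where g: "g = {a, b}" and ab: "(a, b) \<in> oriented_geodesics"
    and h: "h = {c, d}" and cd: "(c, d) \<in> oriented_geodesics" and m: "chord g \<inter> chord h = {m}"
    using gh by (rule transverse_pairsE)
  have "m \<in> hyp_plane" using m by (auto simp: chord_def)
  then obtain e where e: "0 < e" "ball m e \<subseteq> hyp_plane"
    by (metis hyp_plane_def open_ball open_contains_ball)
  obtain v v' where v: "norm v < e" "norm v' < e"
    "side a b (m - v) < 0" "side a b (m - v') < 0" "side a b (m + v') > 0" "side a b (m + v) > 0"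
    "side c d (m - v) < 0" "side c d (m - v') > 0" "side c d (m + v') < 0" "side c d (m + v) > 0"
    using crossing_quadrants [OF ab cd m [unfolded g h] e(1)] by metis
  define x y z w where "x = m - v" and "y = m - v'" and "z = m + v'" and "w = m + v"
  have "{x, y, z, w} \<subseteq> ball m e"
    using v by (simp add: x_def y_def z_def w_def dist_norm)
  then have P: "x \<in> hyp_plane" "y \<in> hyp_plane" "z \<in> hyp_plane" "w \<in> hyp_plane"
    using e(2) by auto
  have gG: "g \<in> separating x y z w" and hH: "h \<in> separating x z y w"
    unfolding g h x_def y_def z_def w_def using ab cd v by (auto intro!: separatingI)
  note dom = diagonals_dominate [OF _ P [unfolded x_def y_def z_def w_def], folded x_def y_def z_def w_def]
  \<comment> \<open>On the neighbourhood of \<open>g\<close> the first sum is 0 and the sum of the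
    diagonals is 2; elsewhere the diagonals dominate weakly. The neighbourhood of \<open>h\<close>
    plays the same part for the second sum.\<close>
  have "(LINT g|\<mu>. weight x y g + weight z w g) < (LINT g|\<mu>. weight y z g + weight x w g)"
    by (rule integral_strict_mono_on_open [OF _ _ dom(1) openin_separating gG])
      (use P null in \<open>auto intro: integrable_weight_sum simp: weight_separating\<close>)
  moreover have "(LINT g|\<mu>. weight x z g + weight y w g) < (LINT g|\<mu>. weight y z g + weight x w g)"
    by (rule integral_strict_mono_on_open [OF _ _ dom(2) openin_separating hH])
      (use P null in \<open>auto intro: integrable_weight_sum simp: weight_separating weight_commute [of y z]\<close>)
  ultimately show False
    using fp [OF P] P by (simp add: four_points_def max_attained_twice_def integrable_weight_sum)
qed

end

theorem corollary6p13:
  fixes X :: "'a::metric_space set" and p :: "complex \<Rightarrow> 'a" and \<mu> :: "complex set measure"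
  assumes "closed_orientable_hyperbolic_surface X"
    and "hyperbolic_universal_cover X p"
    and "geodesic_current p \<mu>"
  shows "zero_hyperbolic (dual_space \<mu>) (dual_dist \<mu>) \<longleftrightarrow> measured_lamination p \<mu>"
proof -
  interpret current p \<mu> by (rule current.intro [OF assms(3)])
  have "covering_space hyp_plane p X"
    using assms(2) by (simp add: hyperbolic_universal_cover_def)
  then have "intersection_number p \<mu> \<mu> = 0 \<longleftrightarrow> no_crossing"
    using no_crossing_if_intersection_zero intersection_zero_if_no_crossing by blast
  moreover have "zero_hyperbolic (dual_space \<mu>) (dual_dist \<mu>) \<longleftrightarrow> no_crossing"
    unfolding zero_hyperbolic_dual_iff
    using four_points_if_no_crossing no_crossing_if_four_points by blast
  ultimately show ?thesis
    using assms(3) by (simp add: measured_lamination_def)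
qed

end
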